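(* Let $\mathcal A$ be a central arrangement in $\mathbb C^{\ell+1}$ with OS algebra $A$, flag space $\mathcal F$, flag differential $d$, weights $a\in\mathbb C^{n+1}$ and contravariant form $S$ (as in the context). Then the subspaces $\operatorname{Ann}(\omega_a\wedge A)$ and $\operatorname{im}(d)$ of $\mathcal F$ are orthogonal with respect to $S$: $S(F,G)=0$ for all $F\in\operatorname{Ann}(\omega_a\wedge A)$ and $G\in\operatorname{im}(d)$.
   Context: Let $\mathcal A=\{H_0,\dots,H_n\}$ be a central arrangement of distinct hyperplanes in $\mathbb C^{\ell+1}$, $H_i=\ker f_i$, with complement $M$, $\omega_i=df_i/f_i$. The OS algebra $A=\bigoplus_pA^p$ is the graded subalgebra of holomorphic forms on $M$ generated by $1,\omega_0,\dots,\omega_n$; $\omega_J=\omega_{j_1}\wedge\cdots\wedge\omega_{j_p}$. Let $L$ be the set of intersections of subfamilies of $\mathcal A$ (including $\mathbb C^{\ell+1}$), ordered by reverse inclusion. A flag of length $p$ is a chain $(X_0<\cdots<X_p)$ in $L$ with $\operatorname{codim}X_i=i$. The flag space $\mathcal F=\bigoplus_p\mathcal F^p$ is the span of flags modulo all sums $\sum_X(X_0<\cdots<X_{i-1}<X<X_{i+1}<\cdots<X_p)$ over $X\in L$ with $X_{i-1}<X<X_{i+1}$, $\operatorname{codim}X=i$ (for all chains $X_0<\cdots<X_{i-1}<X_{i+1}<\cdots<X_p$ with $\operatorname{codim}X_j=j$); images written $[X_0<\cdots<X_p]$. The pairing $\langle\,,\rangle:\mathcal F^p\otimes A^p\to\mathbb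 C$ is $\langle F,\omega_J\rangle=\operatorname{sgn}(\sigma)$ if $F$ equals the chain with $X_0=\mathbb C^{\ell+1}$, $X_k=H_{j_{\sigma(1)}}\cap\cdots\cap H_{j_{\sigma(k)}}$ for some permutation $\sigma$, and $0$ otherwise; it is well defined, nondegenerate, and $\mathcal F^p$ pairs trivially with $A^q$ for $q\ne p$. For $U\subseteq A$, $\operatorname{Ann}(U)=\{F\in\mathcal F:\langle F,u\rangle=0\ \forall u\in U\}$. The flag differential is $d[X_0<\cdots<X_p]=\sum_{X>X_p,\ \operatorname{codim}X=p+1}[X_0<\cdots<X_p<X]$. For $a=(a_0,\dots,a_n)\in\mathbb C^{n+1}$, $\omega_a=\sum_ia_i\omega_i$ and $\omega_a\wedge A=\{\omega_a\wedge x:x\in A\}$. The contravariant form $S=\bigoplus_pS_p$ on $\mathcal F$ has $S_p(F,F')=\sum_Ja_J\langle F,\omega_J\rangle\langle F',\omega_J\rangle$ on $\mathcal F^p$ (sum over increasing $J=(j_1<\cdots<j_p)$ in $\{0,\dots,n\}$, $a_J=\prod_ka_{j_k}$), and $S(\mathcal F^p,\mathcal F^q)=0$ for $p\neq q$. *)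

theory Defs
  imports "HOL-Analysis.Analysis" "HOL-Combinatorics.Permutations" "HOL-Library.Function_Algebras"
begin

definition hyp :: "(nat \<Rightarrow> complex^'m \<Rightarrow> complex) \<Rightarrow> nat \<Rightarrow> (complex^'m) set" where
  "hyp f i = {x. f i x = 0}"

text \<open>The hyperplanes are \<open>hyp f i\<close> for \<open>i \<le> n\<close>, in the complex vector space of dimension
  \<open>CARD('m)\<close>. The values of \<open>f\<close> at indices above \<open>n\<close> are never used.\<close>

definition central_arrangement :: "nat \<Rightarrow> (nat \<Rightarrow> complex^'m \<Rightarrow> complex) \<Rightarrow> bool" where
  "central_arrangement n f \<longleftrightarrow>
     (\<forall>i\<le>n. Vector_Spaces.linear (*s) (*) (f i) \<and> (\<exists>x. f i x \<noteq> 0)) \<and>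
     inj_on (hyp f) {..n}"

definition arr_complement :: "nat \<Rightarrow> (nat \<Rightarrow> complex^'m \<Rightarrow> complex) \<Rightarrow> (complex^'m) set" where
  "arr_complement n f = - (\<Union>i\<le>n. hyp f i)"

text \<open>The empty subfamily contributes the whole space. The order on \<open>intersections\<close> is reverse
  inclusion, so \<open>X < Y\<close> in the poset is written \<open>Y \<subset> X\<close> below.\<close>

definition intersections :: "nat \<Rightarrow> (nat \<Rightarrow> complex^'m \<Rightarrow> complex) \<Rightarrow> (complex^'m) set set" where
  "intersections n f = {(\<Inter>i\<in>I. hyp f i) | I. I \<subseteq> {..n}}"

definition codim :: "(complex^'m) set \<Rightarrow> nat" where
  "codim X = CARD('m) - vec.dim X"

text \<open>A (not necessarily homogeneous) differential form \<open>\<phi>\<close> sends a point \<open>x\<close> and a list of tangent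
  vectors to a number; its component of degree \<open>p\<close> is its restriction to lists of length \<open>p\<close>.
  Forms on the complement are extended by zero to the other points.\<close>

type_synonym 'm form = "complex^'m \<Rightarrow> (complex^'m) list \<Rightarrow> complex"

definition form_one :: "nat \<Rightarrow> (nat \<Rightarrow> complex^'m \<Rightarrow> complex) \<Rightarrow> 'm form" where
  "form_one n f = (\<lambda>x vs. if x \<in> arr_complement n f \<and> vs = [] then 1 else 0)"

text \<open>The logarithmic form \<open>df\<^sub>i / f\<^sub>i\<close>; since \<open>f i\<close> is linear, its differential at every point
  is \<open>f i\<close> itself.\<close>

definition omega :: "nat \<Rightarrow> (nat \<Rightarrow> complex^'m \<Rightarrow> complex) \<Rightarrow> nat \<Rightarrow> 'm form" where
  "omega n f i = (\<lambda>x vs. if x \<in> arr_complement n f \<and> length vs = 1 then f i (hd vs) / f i x else 0)"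

text \<open>The wedge product as a sum over shuffles: \<open>S\<close> is the set of positions of the vectors
  handed to the first factor, and the sign is that of the corresponding shuffle.\<close>

definition shuffle_sign :: "nat \<Rightarrow> nat set \<Rightarrow> complex" where
  "shuffle_sign m S = (- 1) ^ card {(i, j). i \<in> {..<m} - S \<and> j \<in> S \<and> i < j}"

definition wedge :: "'m::finite form \<Rightarrow> 'm form \<Rightarrow> 'm form" where
  "wedge \<phi> \<psi> = (\<lambda>x vs. \<Sum>S \<in> Pow {..<length vs}.
     shuffle_sign (length vs) S * \<phi> x (nths vs S) * \<psi> x (nths vs (- S)))"

inductive_set OS_algebra :: "nat \<Rightarrow> (nat \<Rightarrow> complex^'m \<Rightarrow> complex) \<Rightarrow> 'm form set"
  for n :: nat and f :: "nat \<Rightarrow> complex^'m \<Rightarrow> complex" where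
  one: "form_one n f \<in> OS_algebra n f"
| gen: "i \<le> n \<Longrightarrow> omega n f i \<in> OS_algebra n f"
| scale: "\<phi> \<in> OS_algebra n f \<Longrightarrow> (\<lambda>x vs. c * \<phi> x vs) \<in> OS_algebra n f"
| add: "\<phi> \<in> OS_algebra n f \<Longrightarrow> \<psi> \<in> OS_algebra n f \<Longrightarrow> (\<lambda>x vs. \<phi> x vs + \<psi> x vs) \<in> OS_algebra n f"
| mult: "\<phi> \<in> OS_algebra n f \<Longrightarrow> \<psi> \<in> OS_algebra n f \<Longrightarrow> wedge \<phi> \<psi> \<in> OS_algebra n f"

definition omega_mono :: "nat \<Rightarrow> (nat \<Rightarrow> complex^'m \<Rightarrow> complex) \<Rightarrow> nat list \<Rightarrow> 'm form" where
  "omega_mono n f J = foldr wedge (map (omega n f) J) (form_one n f)"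

definition omega_weight ::
  "nat \<Rightarrow> (nat \<Rightarrow> complex^'m \<Rightarrow> complex) \<Rightarrow> (nat \<Rightarrow> complex) \<Rightarrow> 'm form" where
  "omega_weight n f a = (\<lambda>x vs. \<Sum>i\<le>n. a i * omega n f i x vs)"

definition increasing_tuples :: "nat \<Rightarrow> nat list set" where
  "increasing_tuples n = {J. sorted_wrt (<) J \<and> set J \<subseteq> {..n}}"

text \<open>A flag of length \<open>p\<close> is a list with \<open>p + 1\<close> entries.\<close>

definition flags :: "nat \<Rightarrow> (nat \<Rightarrow> complex^'m \<Rightarrow> complex) \<Rightarrow> (complex^'m) set list set" where
  "flags n f = {G. G \<noteq> [] \<and>
     (\<forall>k<length G. G ! k \<in> intersections n f \<and> codim (G ! k) = k) \<and>
     (\<forall>k. Suc k < length G \<longrightarrow> G ! Suc k \<subset> G ! k)}"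

interpretation fun_vs: vector_space "\<lambda>(c::complex) (g::'a \<Rightarrow> complex) x. c * g x"
  by unfold_locales (auto simp: fun_eq_iff algebra_simps)

text \<open>There are finitely many flags, so the free vector space on them consists of all functions
  vanishing off \<open>flags n f\<close>.\<close>

definition free_flags ::
  "nat \<Rightarrow> (nat \<Rightarrow> complex^'m \<Rightarrow> complex) \<Rightarrow> ((complex^'m) set list \<Rightarrow> complex) set" where
  "free_flags n f = {c. \<forall>G. G \<notin> flags n f \<longrightarrow> c G = 0}"

definition flag_vec :: "(complex^'m) set list \<Rightarrow> (complex^'m) set list \<Rightarrow> complex" where
  "flag_vec G = (\<lambda>G'. if G' = G then 1 else 0)"

text \<open>The relators: \<open>Ys = (X\<^sub>0 < \<dots> < X\<^sub>i\<^sub>-\<^sub>1)\<close> and \<open>Zs = (X\<^sub>i\<^sub>+\<^sub>1 < \<dots> < X\<^sub>p)\<close>,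
  with \<open>i = length Ys\<close> and both parts nonempty, i.e. \<open>0 < i < p\<close>.\<close>

definition flag_relators ::
  "nat \<Rightarrow> (nat \<Rightarrow> complex^'m \<Rightarrow> complex) \<Rightarrow> ((complex^'m) set list \<Rightarrow> complex) set" where
  "flag_relators n f =
     {(\<Sum>X | X \<in> intersections n f \<and> X \<subset> last Ys \<and> hd Zs \<subset> X \<and> codim X = length Ys.
         flag_vec (Ys @ X # Zs)) | Ys Zs.
       Ys \<in> flags n f \<and> Zs \<noteq> [] \<and> hd Zs \<subset> last Ys \<and>
       (\<forall>k<length Zs. Zs ! k \<in> intersections n f \<and> codim (Zs ! k) = length Ys + 1 + k) \<and>
       (\<forall>k. Suc k < length Zs \<longrightarrow> Zs ! Suc k \<subset> Zs ! k)}"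

definition flag_rel ::
  "nat \<Rightarrow> (nat \<Rightarrow> complex^'m \<Rightarrow> complex) \<Rightarrow> ((complex^'m) set list \<Rightarrow> complex) rel" where
  "flag_rel n f = {(c, c'). c \<in> free_flags n f \<and> c' \<in> free_flags n f \<and>
     c - c' \<in> fun_vs.span (flag_relators n f)}"

definition flag_space ::
  "nat \<Rightarrow> (nat \<Rightarrow> complex^'m \<Rightarrow> complex) \<Rightarrow> ((complex^'m) set list \<Rightarrow> complex) set set" where
  "flag_space n f = free_flags n f // flag_rel n f"

definition pre_diff :: "nat \<Rightarrow> (nat \<Rightarrow> complex^'m \<Rightarrow> complex) \<Rightarrow>
    ((complex^'m) set list \<Rightarrow> complex) \<Rightarrow> (complex^'m) set list \<Rightarrow> complex" where
  "pre_diff n f c = (\<lambda>G'. \<Sum>G \<in> flags n f. c G *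
     (\<Sum>X | X \<in> intersections n f \<and> X \<subset> last G \<and> codim X = length G. flag_vec (G @ [X]) G'))"

definition flag_diff :: "nat \<Rightarrow> (nat \<Rightarrow> complex^'m \<Rightarrow> complex) \<Rightarrow>
    ((complex^'m) set list \<Rightarrow> complex) set \<Rightarrow> ((complex^'m) set list \<Rightarrow> complex) set" where
  "flag_diff n f F = (\<Union>c\<in>F. flag_rel n f `` {pre_diff n f c})"

definition chain_of ::
  "(nat \<Rightarrow> complex^'m \<Rightarrow> complex) \<Rightarrow> nat list \<Rightarrow> (nat \<Rightarrow> nat) \<Rightarrow> (complex^'m) set list" where
  "chain_of f J \<sigma> = map (\<lambda>k. \<Inter>i<k. hyp f (J ! \<sigma> i)) [0..<Suc (length J)]"

text \<open>The value of the pairing on a flag and a monomial. For a flag \<open>G\<close> there is at most one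
  such \<open>\<sigma>\<close>.\<close>

definition flag_eval ::
  "(nat \<Rightarrow> complex^'m \<Rightarrow> complex) \<Rightarrow> (complex^'m) set list \<Rightarrow> nat list \<Rightarrow> complex" where
  "flag_eval f G J =
     (if \<exists>\<sigma>. \<sigma> permutes {..<length J} \<and> G = chain_of f J \<sigma>
      then of_int (sign (THE \<sigma>. \<sigma> permutes {..<length J} \<and> G = chain_of f J \<sigma>)) else 0)"

text \<open>The bilinear extension of \<open>flag_eval\<close> to classes of flags and forms in the Orlik-Solomon
  algebra, the latter being linear combinations of the monomials; the value is independent of the
  representative \<open>c\<close> and of the coefficients \<open>b\<close>. Components of different degrees
  pair to zero, because a flag of length \<open>p\<close> equals no chain \<open>chain_of f J \<sigma>\<close>
  with \<open>length J \<noteq> p\<close>.\<close>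

definition flag_pairing :: "nat \<Rightarrow> (nat \<Rightarrow> complex^'m \<Rightarrow> complex) \<Rightarrow>
    ((complex^'m) set list \<Rightarrow> complex) set \<Rightarrow> 'm form \<Rightarrow> complex" where
  "flag_pairing n f F u = (THE z. \<exists>c\<in>F. \<exists>b.
     u = (\<lambda>x vs. \<Sum>J \<in> increasing_tuples n. b J * omega_mono n f J x vs) \<and>
     z = (\<Sum>G \<in> flags n f. \<Sum>J \<in> increasing_tuples n. c G * b J * flag_eval f G J))"

definition Ann :: "nat \<Rightarrow> (nat \<Rightarrow> complex^'m \<Rightarrow> complex) \<Rightarrow> 'm form set \<Rightarrow>
    ((complex^'m) set list \<Rightarrow> complex) set set" where
  "Ann n f U = {F \<in> flag_space n f. \<forall>u\<in>U. flag_pairing n f F u = 0}"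

definition contravariant_deg :: "nat \<Rightarrow> (nat \<Rightarrow> complex^'m \<Rightarrow> complex) \<Rightarrow> (nat \<Rightarrow> complex) \<Rightarrow> nat \<Rightarrow>
    ((complex^'m) set list \<Rightarrow> complex) set \<Rightarrow> ((complex^'m) set list \<Rightarrow> complex) set \<Rightarrow> complex" where
  "contravariant_deg n f a p F F' =
     (\<Sum>J | J \<in> increasing_tuples n \<and> length J = p. (\<Prod>k<p. a (J ! k)) *
        flag_pairing n f F (omega_mono n f J) * flag_pairing n f F' (omega_mono n f J))"

text \<open>The direct sum of the forms above. No projection to the components of degree \<open>p\<close> is needed:
  a monomial of degree \<open>p\<close> only pairs with those components. The degrees
  above \<open>n + 1\<close> contribute nothing, as there are no increasing tuples of that length.\<close>

definition contravariant_form :: "nat \<Rightarrow> (nat \<Rightarrow> complex^'m \<Rightarrow> complex) \<Rightarrow> (nat \<Rightarrow> complex) \<Rightarrow>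
    ((complex^'m) set list \<Rightarrow> complex) set \<Rightarrow> ((complex^'m) set list \<Rightarrow> complex) set \<Rightarrow> complex" where
  "contravariant_form n f a F F' = (\<Sum>p\<le>n + 1. contravariant_deg n f a p F F')"

end

theory Submission
  imports Defs "Jordan_Normal_Form.Determinant"
begin

text \<open>
  Both sides of the pairing are determinants. A monomial \<open>\<omega>\<^sub>J\<close> evaluates to the determinant of
  \<open>f\<^sub>j (v\<^sub>k) / f\<^sub>j (x)\<close>, and its value on a flag is the determinant of the matrix recording at
  which step of the flag each hyperplane starts to contain the space. The second matrix is the limit
  of the first one when \<open>x\<close> approaches the last space of the flag through its larger spaces at
  successively faster rates (an iterated residue), so the pairing only depends on the form.
  The relators pair to zero, since summing over the middle space produces two equal columns.

  Expanding along the last column gives \<open>\<langle>d G, \<omega>\<^sub>J\<rangle> = \<plusminus> \<langle>G, \<partial> \<omega>\<^sub>J\<rangle>\<close>, where \<open>\<partial>\<close> is the contraction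
  \<open>\<omega>\<^sub>J \<mapsto> \<Sum>\<^sub>k (- 1)\<^sup>k \<omega>\<^sub>J\<^sub>-\<^sub>k\<close>. Substituting this in \<open>S(F, d G)\<close> and regrouping the pairs \<open>(J, k)\<close> as pairs
  \<open>(I, i)\<close> with \<open>J = I \<union> {i}\<close> gives \<open>\<Sum>\<^sub>I \<plusminus> a\<^sub>I \<langle>G, \<omega>\<^sub>I\<rangle> \<langle>F, \<omega>\<^sub>a \<and> \<omega>\<^sub>I\<rangle>\<close>, which vanishes for \<open>F\<close>
  in the annihilator.
\<close>

section \<open>Determinants\<close>

text \<open>The entries are given as a function of row and column, so that a single column can be
  replaced by function update. Only entries with both indices below \<open>p\<close> matter.\<close>

definition fdet :: "nat \<Rightarrow> (nat \<Rightarrow> nat \<Rightarrow> complex) \<Rightarrow> complex" where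
  "fdet p h = Determinant.det (mat p p (\<lambda>(i, j). h i j))"

definition drop_nth :: "nat \<Rightarrow> 'a list \<Rightarrow> 'a list" where
  "drop_nth k xs = take k xs @ drop (Suc k) xs"

lemma length_drop_nth [simp]: "k < length xs \<Longrightarrow> length (drop_nth k xs) = length xs - 1"
  by (simp add: drop_nth_def)

lemma nth_drop_nth:
  "k < length xs \<Longrightarrow> i < length xs - 1 \<Longrightarrow> drop_nth k xs ! i = xs ! (if i < k then i else Suc i)"
  by (auto simp: drop_nth_def nth_append min_def)

lemma set_drop_nth_subset: "set (drop_nth k xs) \<subseteq> set xs"
  by (auto simp: drop_nth_def dest: in_set_takeD in_set_dropD)

lemma fdet_cong:
  "(\<And>i j. i < p \<Longrightarrow> j < p \<Longrightarrow> h i j = h' i j) \<Longrightarrow> fdet p h = fdet p h'"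
  unfolding fdet_def by (intro arg_cong[where f = Determinant.det]) (auto intro!: eq_matI)

lemma fdet_0 [simp]: "fdet 0 h = 1"
  unfolding fdet_def by (rule det_dim_zero) simp

lemma fdet_leibniz:
  "fdet p h = (\<Sum>\<sigma> | \<sigma> permutes {..<p}. of_int (sign \<sigma>) * (\<Prod>i<p. h i (\<sigma> i)))"
proof -
  have "fdet p h = (\<Sum>\<sigma> | \<sigma> permutes {0..<p}. of_int (sign \<sigma>) *
      (\<Prod>i = 0..<p. mat p p (\<lambda>(i, j). h i j) $$ (i, \<sigma> i)))"
    unfolding fdet_def by (rule det_def') simp
  also have "\<dots> = (\<Sum>\<sigma> | \<sigma> permutes {0..<p}. of_int (sign \<sigma>) * (\<Prod>i = 0..<p. h i (\<sigma> i)))"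
    by (intro sum.cong refl arg_cong2[where f = "(*)"] prod.cong)
      (auto dest: permutes_in_image)
  finally show ?thesis by (simp add: atLeast0LessThan)
qed

text \<open>Expansion along the first row has the shape of a wedge product with a one-form on the
  left; it supplies the inductive step of the formula for monomials.\<close>

lemma fdet_row0:
  "fdet (Suc p) h = (\<Sum>j<Suc p. (-1)^j * h 0 j *
     fdet p (\<lambda>i l. h (Suc i) (if l < j then l else Suc l)))"
proof -
  have "fdet (Suc p) h = (\<Sum>j<Suc p. mat (Suc p) (Suc p) (\<lambda>(i, j). h i j) $$ (0, j) *
     cofactor (mat (Suc p) (Suc p) (\<lambda>(i, j). h i j)) 0 j)"
    unfolding fdet_def by (rule laplace_expansion_row) auto
  also have "\<dots> = (\<Sum>j<Suc p. (-1)^j * h 0 j *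
      fdet p (\<lambda>i l. h (Suc i) (if l < j then l else Suc l)))"
    unfolding cofactor_def fdet_def mat_delete_def
    by (intro sum.cong refl) (auto intro!: arg_cong[where f = Determinant.det] eq_matI)
  finally show ?thesis .
qed

lemma fdet_column:
  assumes "c < p"
  shows "fdet p h = (\<Sum>i<p. (-1)^(i + c) * h i c *
     fdet (p - 1) (\<lambda>k l. h (if k < i then k else Suc k) (if l < c then l else Suc l)))"
proof -
  have "fdet p h = (\<Sum>i<p. mat p p (\<lambda>(i, j). h i j) $$ (i, c) *
     cofactor (mat p p (\<lambda>(i, j). h i j)) i c)"
    unfolding fdet_def using assms by (intro laplace_expansion_column) auto
  also have "\<dots> = (\<Sum>i<p. (-1)^(i + c) * h i c *
     fdet (p - 1) (\<lambda>k l. h (if k < i then k else Suc k) (if l < c then l else Suc l)))"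
    unfolding cofactor_def fdet_def mat_delete_def using assms
    by (intro sum.cong refl) (auto intro!: arg_cong[where f = Determinant.det] eq_matI)
  finally show ?thesis .
qed

text \<open>In the expansion along column \<open>c\<close> the minors skip that column. They do not
  change when it is replaced, so the determinant is linear in it.\<close>

lemma fdet_column_sum:
  assumes "c < p"
  shows "fdet p (\<lambda>i. (h i)(c := \<Sum>x\<in>T. g x i)) = (\<Sum>x\<in>T. fdet p (\<lambda>i. (h i)(c := g x i)))"
proof -
  have E: "fdet p (\<lambda>i. (h i)(c := u i)) = (\<Sum>i<p. (-1)^(i + c) * u i *
     fdet (p - 1) (\<lambda>k l. h (if k < i then k else Suc k) (if l < c then l else Suc l)))" for u
    by (subst fdet_column[OF assms], intro sum.cong refl arg_cong2[where f = "(*)"] fdet_cong)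
      (auto)
  show ?thesis
    unfolding E by (subst sum.swap) (simp add: sum_distrib_left sum_distrib_right)
qed

lemma fdet_column_diff:
  assumes "c < p"
  shows "fdet p (\<lambda>i. (h i)(c := u i - v i)) =
    fdet p (\<lambda>i. (h i)(c := u i)) - fdet p (\<lambda>i. (h i)(c := v i))"
proof -
  have E: "fdet p (\<lambda>i. (h i)(c := u i)) = (\<Sum>i<p. (-1)^(i + c) * u i *
     fdet (p - 1) (\<lambda>k l. h (if k < i then k else Suc k) (if l < c then l else Suc l)))" for u
    by (subst fdet_column[OF assms], intro sum.cong refl arg_cong2[where f = "(*)"] fdet_cong)
      (auto)
  show ?thesis
    unfolding E by (simp add: algebra_simps sum_subtractf)
qed

lemma fdet_equal_columns:
  assumes "c < p" "c' < p" "c \<noteq> c'" "\<And>i. i < p \<Longrightarrow> h i c = h i c'"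
  shows "fdet p h = 0"
  unfolding fdet_def
  by (rule det_identical_columns[of _ p c c']) (use assms in \<open>auto intro!: eq_vecI\<close>)

lemma fdet_equal_rows:
  assumes "k < p" "l < p" "k \<noteq> l" "\<And>j. j < p \<Longrightarrow> h k j = h l j"
  shows "fdet p h = 0"
  unfolding fdet_def
  by (rule det_identical_rows[of _ p k l]) (use assms in \<open>auto intro!: eq_vecI\<close>)

lemma fdet_swap_rows:
  assumes "k < p" "l < p" "k \<noteq> l"
  shows "fdet p (\<lambda>i. h (Transposition.transpose k l i)) = - fdet p h"
proof -
  have "fdet p (\<lambda>i. h (Transposition.transpose k l i)) =
      Determinant.det (swaprows k l (mat p p (\<lambda>(i, j). h i j)))"
    unfolding fdet_def using assms
    by (intro arg_cong[where f = Determinant.det]) (auto intro!: eq_matI simp: transpose_def)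
  also have "\<dots> = - fdet p h"
    unfolding fdet_def by (rule det_swaprows) (use assms in auto)
  finally show ?thesis .
qed

text \<open>By the Leibniz formula the determinant is a polynomial in its entries.\<close>

lemma tendsto_fdet:
  assumes "\<And>i j. i < p \<Longrightarrow> j < p \<Longrightarrow> ((\<lambda>x. h x i j) \<longlongrightarrow> l i j) F"
  shows "((\<lambda>x. fdet p (h x)) \<longlongrightarrow> fdet p l) F"
  unfolding fdet_leibniz
  by (intro tendsto_intros assms) (auto dest: permutes_in_image)

section \<open>Monomials as determinants\<close>

lemma nths_remove_nth: "k < length xs \<Longrightarrow> nths xs (- {k}) = drop_nth k xs"
proof (induction xs arbitrary: k)
  case (Cons x xs)
  show ?case
  proof (cases k)
    case 0
    then show ?thesis by (simp add: nths_Cons drop_nth_def nths_all)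
  next
    case (Suc l)
    moreover have "{j. Suc j \<noteq> Suc l} = - {l}" by auto
    ultimately show ?thesis
      using Cons by (simp add: nths_Cons drop_nth_def)
  qed
qed simp

lemma nths_nth: "k < length xs \<Longrightarrow> nths xs {k} = [xs ! k]"
proof (induction xs arbitrary: k)
  case (Cons x xs)
  show ?case
  proof (cases k)
    case 0
    then show ?thesis by (simp add: nths_Cons)
  next
    case (Suc l)
    moreover have "{j. j = l} = {l}" by auto
    ultimately show ?thesis
      using Cons by (simp add: nths_Cons)
  qed
qed simp

text \<open>The \<open>k\<close> positions before the chosen one go to the second factor, and each
  contributes one inversion.\<close>

lemma shuffle_sign_singleton:
  assumes "k < m"
  shows "shuffle_sign m {k} = (-1) ^ k"
proof -
  have "{(i, j). i \<in> {..<m} - {k} \<and> j \<in> {k} \<and> i < j} = (\<lambda>i. (i, k)) ` {..<k}"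
    using assms by auto
  moreover have "card ((\<lambda>i. (i, k)) ` {..<k}) = k"
    by (subst card_image) (auto simp: inj_on_def)
  ultimately show ?thesis by (simp add: shuffle_sign_def)
qed

text \<open>A one-form vanishes unless it receives exactly one vector, so only the shuffles given by
  singletons survive.\<close>

lemma wedge_one_form:
  assumes "\<And>vs. length vs \<noteq> 1 \<Longrightarrow> \<phi> x vs = 0"
  shows "wedge \<phi> \<psi> x vs =
    (\<Sum>k<length vs. (-1)^k * \<phi> x [vs ! k] * \<psi> x (drop_nth k vs))"
proof -
  let ?m = "length vs"
  let ?t = "\<lambda>S. shuffle_sign ?m S * \<phi> x (nths vs S) * \<psi> x (nths vs (- S))"
  have "sum ?t (Pow {..<?m}) = sum ?t ((\<lambda>k. {k}) ` {..<?m})"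
  proof (rule sum.mono_neutral_right)
    show "\<forall>S \<in> Pow {..<?m} - (\<lambda>k. {k}) ` {..<?m}. ?t S = 0"
    proof
      fix S assume S: "S \<in> Pow {..<?m} - (\<lambda>k. {k}) ` {..<?m}"
      have "length (nths vs S) = card S"
        using S by (auto simp: length_nths intro!: arg_cong[where f = card])
      moreover have "card S \<noteq> 1"
        using S by (auto simp: card_1_singleton_iff)
      ultimately show "?t S = 0" using assms by simp
    qed
  qed auto
  also have "\<dots> = (\<Sum>k<?m. ?t {k})"
    by (subst sum.reindex) (auto simp: inj_on_def)
  finally show ?thesis
    by (simp add: wedge_def nths_nth nths_remove_nth shuffle_sign_singleton)
qed

lemma omega_mono_Cons: "omega_mono n f (i # J) = wedge (omega n f i) (omega_mono n f J)"
  by (simp add: omega_mono_def)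

text \<open>Induction on \<open>J\<close>: wedging with one more logarithmic form on the left is the
  expansion along a new first row.\<close>

lemma omega_mono_eq_fdet:
  "omega_mono n f J x vs =
    (if x \<in> arr_complement n f \<and> length vs = length J
     then fdet (length J) (\<lambda>i k. f (J ! i) (vs ! k) / f (J ! i) x) else 0)"
proof (induction J arbitrary: vs)
  case Nil
  then show ?case by (simp add: omega_mono_def form_one_def)
next
  case (Cons i J)
  have *: "omega_mono n f (i # J) x vs =
      (\<Sum>k<length vs. (-1)^k * omega n f i x [vs ! k] * omega_mono n f J x (drop_nth k vs))"
    unfolding omega_mono_Cons by (rule wedge_one_form) (simp add: omega_def)
  show ?case
  proof (cases "x \<in> arr_complement n f \<and> length vs = Suc (length J)")
    case True
    have "omega_mono n f (i # J) x vs = (\<Sum>k<Suc (length J). (-1)^k * (f i (vs ! k) / f i x) *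
      fdet (length J) (\<lambda>l m. f (J ! l) (vs ! (if m < k then m else Suc m)) / f (J ! l) x))"
      unfolding * using True
      by (intro sum.cong arg_cong2[where f = "(*)"])
        (auto simp: omega_def Cons.IH nth_drop_nth simp del: sum.lessThan_Suc intro!: fdet_cong)
    also have "\<dots> = fdet (Suc (length J)) (\<lambda>l k. f ((i # J) ! l) (vs ! k) / f ((i # J) ! l) x)"
      by (simp add: fdet_row0 del: sum.lessThan_Suc)
    finally show ?thesis using True by simp
  next
    case False
    then show ?thesis
      unfolding * by (auto simp: omega_def Cons.IH intro!: sum.neutral)
  qed
qed

text \<open>Exchanging the two leading factors exchanges the first two rows of the
  determinant.\<close>

lemma omega_mono_swap: "omega_mono n f (i # j # J) = (\<lambda>x vs. - omega_mono n f (j # i # J) x vs)"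
proof (intro ext)
  fix x vs
  have "fdet (Suc (Suc (length J))) (\<lambda>l k. f ((i # j # J) ! l) (vs ! k) / f ((i # j # J) ! l) x) =
      fdet (Suc (Suc (length J))) (\<lambda>l. (\<lambda>l k. f ((j # i # J) ! l) (vs ! k) / f ((j # i # J) ! l) x)
        (Transposition.transpose 0 1 l))"
    by (intro fdet_cong) (auto simp: transpose_def nth_Cons split: nat.splits)
  also have "\<dots> = - fdet (Suc (Suc (length J))) (\<lambda>l k. f ((j # i # J) ! l) (vs ! k) / f ((j # i # J) ! l) x)"
    by (rule fdet_swap_rows) auto
  finally show "omega_mono n f (i # j # J) x vs = - omega_mono n f (j # i # J) x vs"
    unfolding omega_mono_eq_fdet by simp
qed

lemma wedge_scale_right: "wedge \<phi> (\<lambda>x vs. c * \<psi> x vs) = (\<lambda>x vs. c * wedge \<phi> \<psi> x vs)"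
  by (simp add: wedge_def sum_distrib_left algebra_simps)

text \<open>The leading factor passes the entries of \<open>I\<close> one at a time, and each
  exchange costs a sign.\<close>

lemma omega_mono_move:
  "omega_mono n f (i # I @ J) = (\<lambda>x vs. (-1) ^ length I * omega_mono n f (I @ i # J) x vs)"
proof (induction I)
  case (Cons j I)
  have "omega_mono n f (i # (j # I) @ J) =
      (\<lambda>x vs. - wedge (omega n f j) (omega_mono n f (i # I @ J)) x vs)"
    by (simp add: omega_mono_swap[of n f i] omega_mono_Cons[of n f j])
  then show ?case
    unfolding Cons.IH wedge_scale_right by (simp add: omega_mono_Cons)
qed simp

lemma omega_mono_repeated:
  assumes "i \<in> set I"
  shows "omega_mono n f (i # I) = (\<lambda>x vs. 0)"
proof (intro ext)
  fix x vs
  obtain k where "k < length I" "I ! k = i"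
    using assms by (auto simp: in_set_conv_nth)
  then have "fdet (length (i # I)) (\<lambda>l k. f ((i # I) ! l) (vs ! k) / f ((i # I) ! l) x) = 0"
    by (intro fdet_equal_rows[of 0 _ "Suc k"]) auto
  then show "omega_mono n f (i # I) x vs = 0"
    unfolding omega_mono_eq_fdet by simp
qed

lemma wedge_omega_weight:
  "wedge (omega_weight n f a) u = (\<lambda>x vs. \<Sum>i\<le>n. a i * wedge (omega n f i) u x vs)"
proof (intro ext)
  fix x vs
  let ?s = "\<lambda>S. shuffle_sign (length vs) S" and ?u = "\<lambda>S. u x (nths vs (- S))"
  have "wedge (omega_weight n f a) u x vs =
      (\<Sum>S\<in>Pow {..<length vs}. \<Sum>i\<le>n. a i * (?s S * omega n f i x (nths vs S) * ?u S))"
    unfolding wedge_def omega_weight_def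
    by (intro sum.cong refl) (simp add: sum_distrib_left sum_distrib_right algebra_simps)
  also have "\<dots> = (\<Sum>i\<le>n. a i * wedge (omega n f i) u x vs)"
    unfolding wedge_def by (subst sum.swap) (simp add: sum_distrib_left)
  finally show "wedge (omega_weight n f a) u x vs = (\<Sum>i\<le>n. a i * wedge (omega n f i) u x vs)" .
qed

lemma omega_mono_in_OS_algebra:
  "set J \<subseteq> {..n} \<Longrightarrow> omega_mono n f J \<in> OS_algebra n f"
proof (induction J)
  case Nil
  then show ?case by (simp add: omega_mono_def OS_algebra.one)
next
  case (Cons i J)
  then show ?case by (auto simp: omega_mono_Cons intro!: OS_algebra.mult OS_algebra.gen)
qed

section \<open>Insertion into increasing tuples and deletion from them\<close>

definition position :: "nat \<Rightarrow> nat list \<Rightarrow> nat" where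
  "position i I = length (takeWhile (\<lambda>j. j < i) I)"

lemma insort_conv_takeWhile:
  fixes i :: nat
  shows "insort i I = takeWhile (\<lambda>j. j < i) I @ i # dropWhile (\<lambda>j. j < i) I"
  by (induction I) auto

text \<open>The entries of \<open>I\<close> that \<open>i\<close> has to pass on its way from the
  front to its sorted place are counted by \<open>position i I\<close>.\<close>

lemma omega_mono_insort:
  "omega_mono n f (i # I) = (\<lambda>x vs. (-1) ^ position i I * omega_mono n f (insort i I) x vs)"
  using omega_mono_move[of n f i "takeWhile (\<lambda>j. j < i) I" "dropWhile (\<lambda>j. j < i) I"]
  by (simp add: insort_conv_takeWhile position_def)

lemma length_increasing_tuple: "J \<in> increasing_tuples n \<Longrightarrow> length J \<le> Suc n"
  by (auto simp: increasing_tuples_def strict_sorted_iff)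
    (metis card_mono card_atMost distinct_card finite_atMost)

lemma finite_increasing_tuples [simp]: "finite (increasing_tuples n)"
proof (rule finite_subset)
  show "increasing_tuples n \<subseteq> {J. set J \<subseteq> {..n} \<and> length J \<le> Suc n}"
    using length_increasing_tuple by (auto simp: increasing_tuples_def)
qed (rule finite_lists_length_le, simp)

lemma insort_in_increasing_tuples:
  "I \<in> increasing_tuples n \<Longrightarrow> i \<le> n \<Longrightarrow> i \<notin> set I \<Longrightarrow> insort i I \<in> increasing_tuples n"
  by (auto simp: increasing_tuples_def strict_sorted_iff sorted_insort distinct_insort set_insort_key)

lemma drop_nth_in_increasing_tuples:
  "J \<in> increasing_tuples n \<Longrightarrow> drop_nth k J \<in> increasing_tuples n"
proof -
  assume J: "J \<in> increasing_tuples n"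
  have "sorted_wrt (<) (take k J @ drop k J)"
    using J by (simp add: increasing_tuples_def)
  moreover have "drop (Suc k) J = drop 1 (drop k J)" by simp
  ultimately have "sorted_wrt (<) (drop_nth k J)"
    unfolding drop_nth_def sorted_wrt_append
    by (metis in_set_dropD sorted_wrt_drop)
  with J show ?thesis
    using set_drop_nth_subset[of k J] by (auto simp: increasing_tuples_def)
qed

lemma
  shows drop_nth_position_insort: "drop_nth (position i I) (insort i I) = I"
    and nth_position_insort: "insort i I ! position i I = i"
    and position_less: "position i I < length (insort i I)"
  using takeWhile_dropWhile_id[of "\<lambda>j. j < i" I]
  by (auto simp: position_def insort_conv_takeWhile drop_nth_def)

text \<open>Deleting the \<open>k\<close>-th entry of \<open>J\<close> and inserting a new index
  \<open>i\<close> into \<open>I\<close> are inverse to each other, so the pairs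
  \<open>(J, k)\<close> correspond to the pairs \<open>(I, i)\<close>.\<close>

lemma sum_increasing_tuples_reindex:
  "(\<Sum>J\<in>increasing_tuples n. \<Sum>k<length J. h J k) =
    (\<Sum>I\<in>increasing_tuples n. \<Sum>i\<in>{..n} - set I. h (insort i I) (position i I))"
proof -
  let ?I = "increasing_tuples n"
  have 1: "insort (J ! k) (drop_nth k J) = J" "position (J ! k) (drop_nth k J) = k"
    "J ! k \<le> n" "J ! k \<notin> set (drop_nth k J)"
    if "J \<in> ?I" "k < length J" for J k
  proof -
    have J: "J = take k J @ J ! k # drop (Suc k) J"
      using that by (simp add: id_take_nth_drop)
    have "J ! k \<in> {..n}"
      using that nth_mem[of k J] unfolding increasing_tuples_def by blast
    then show "J ! k \<le> n" by simp
    have "sorted_wrt (<) (take k J @ J ! k # drop (Suc k) J)"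
      using that J by (auto simp: increasing_tuples_def)
    then have lt: "\<forall>x\<in>set (take k J). x < J ! k" "\<forall>x\<in>set (drop (Suc k) J). J ! k < x"
      by (auto simp: sorted_wrt_append)
    \<comment> \<open>All entries before position \<open>k\<close> are smaller than
      \<open>J ! k\<close> and all later ones are larger, so comparison with \<open>J ! k\<close>
      cuts the shortened tuple exactly at \<open>k\<close>.\<close>
    have tw: "takeWhile (\<lambda>j. j < J ! k) (drop_nth k J) = take k J"
      "dropWhile (\<lambda>j. j < J ! k) (drop_nth k J) = drop (Suc k) J"
      using lt by (cases "drop (Suc k) J"; auto simp: drop_nth_def takeWhile_append dropWhile_append)+
    show "insort (J ! k) (drop_nth k J) = J"
      unfolding insort_conv_takeWhile tw using J by simp
    show "position (J ! k) (drop_nth k J) = k"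
      unfolding position_def tw using that by simp
    show "J ! k \<notin> set (drop_nth k J)" using lt by (auto simp: drop_nth_def)
  qed
  show ?thesis
    by (subst (1 2) sum.Sigma, simp, simp, simp, simp,
        rule sum.reindex_bij_witness[where j = "\<lambda>(J, k). (drop_nth k J, J ! k)"
          and i = "\<lambda>(I, i). (insort i I, position i I)"])
      (auto simp: 1 drop_nth_position_insort nth_position_insort position_less drop_nth_in_increasing_tuples insort_in_increasing_tuples simp del: length_insort)
qed

text \<open>As a product over a set, the weight of \<open>J\<close> just gains the factor
  \<open>a i\<close> when a new index \<open>i\<close> is inserted.\<close>

lemma prod_increasing_tuple:
  assumes "J \<in> increasing_tuples n"
  shows "(\<Prod>k<length J. a (J ! k)) = (\<Prod>j\<in>set J. a j)"
proof -
  have "distinct J" using assms by (simp add: increasing_tuples_def strict_sorted_iff)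
  then have "bij_betw ((!) J) {..<length J} (set J)" by (intro bij_betw_nth) auto
  then show ?thesis by (rule prod.reindex_bij_betw)
qed

text \<open>Grouping by the value of \<open>K\<close> turns a finite combination of monomials into
  one with a single coefficient for each increasing tuple, the shape that
  \<open>flag_pairing\<close> asks for.\<close>

lemma sum_increasing_tuples_fibres:
  assumes "finite T" "K ` T \<subseteq> increasing_tuples n"
  shows "(\<Sum>J\<in>increasing_tuples n. (\<Sum>t\<in>{t \<in> T. K t = J}. b t) * y J) = (\<Sum>t\<in>T. b t * y (K t) :: complex)"
proof -
  have "(\<Sum>J\<in>increasing_tuples n. (\<Sum>t\<in>{t \<in> T. K t = J}. b t) * y J) =
      (\<Sum>J\<in>increasing_tuples n. \<Sum>t\<in>{t \<in> T. K t = J}. b t * y (K t))"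
    by (intro sum.cong refl) (simp add: sum_distrib_right)
  also have "\<dots> = (\<Sum>t\<in>T. b t * y (K t))"
    using assms by (intro sum.group) simp_all
  finally show ?thesis .
qed

lemma sum_fun_apply: "(\<Sum>a\<in>A. g a) x = (\<Sum>a\<in>A. g a x)"
  by (induction A rule: infinite_finite_induct) auto

lemma nth_le: "set J \<subseteq> {..n} \<Longrightarrow> i < length J \<Longrightarrow> J ! i \<le> (n::nat)"
  by (meson atMost_iff nth_mem subsetD)

section \<open>Flags of an arrangement\<close>

locale arrangement =
  fixes n :: nat and f :: "nat \<Rightarrow> complex^'m \<Rightarrow> complex"
  assumes central: "central_arrangement n f"
begin

section \<open>Intersections of hyperplanes and their codimensions\<close>

lemma linear_f: "i \<le> n \<Longrightarrow> Vector_Spaces.linear (*s) (*) (f i)"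
  using central by (auto simp: central_arrangement_def)

lemma
  assumes "i \<le> n"
  shows f_add: "f i (x + y) = f i x + f i y"
    and f_scale: "f i (c *s x) = c * f i x"
    and f_zero: "f i 0 = 0"
proof -
  interpret Vector_Spaces.linear "(*s)" "(*)" "f i" by (rule linear_f[OF assms])
  show "f i (x + y) = f i x + f i y" "f i (c *s x) = c * f i x" "f i 0 = 0"
    by (rule add scale zero)+
qed

lemma f_sum:
  assumes "i \<le> n"
  shows "f i (sum g T) = (\<Sum>k\<in>T. f i (g k))"
  by (induction T rule: infinite_finite_induct) (auto simp: f_add f_zero assms)

lemma subspace_intersection: "X \<in> intersections n f \<Longrightarrow> vec.subspace X"
  unfolding intersections_def
  by (auto simp: hyp_def vec.subspace_def f_add f_scale f_zero subset_iff)

lemma UNIV_in_intersections: "UNIV \<in> intersections n f"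
  unfolding intersections_def by (auto intro!: exI[of _ "{}"])

lemma inter_hyp_in_intersections:
  assumes "X \<in> intersections n f" "j \<le> n"
  shows "X \<inter> hyp f j \<in> intersections n f"
proof -
  obtain I where "I \<subseteq> {..n}" "X = (\<Inter>i\<in>I. hyp f i)"
    using assms(1) by (auto simp: intersections_def)
  then show ?thesis
    using assms(2) unfolding intersections_def by (auto intro!: exI[of _ "insert j I"])
qed

lemma not_UNIV_subset_hyp: "j \<le> n \<Longrightarrow> \<not> UNIV \<subseteq> hyp f j"
  using central by (auto simp: central_arrangement_def hyp_def)

lemma finite_intersections [simp]: "finite (intersections n f)"
proof -
  have "intersections n f = (\<lambda>I. \<Inter>i\<in>I. hyp f i) ` Pow {..n}"
    by (auto simp: intersections_def)
  then show ?thesis by simp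
qed

text \<open>A vector \<open>y\<close> of \<open>X\<close> outside the hyperplane spans
  \<open>X\<close> together with the intersection, so the dimension drops by exactly one.\<close>

lemma codim_inter_hyp:
  assumes X: "X \<in> intersections n f" and j: "j \<le> n" and "\<not> X \<subseteq> hyp f j"
  shows "codim (X \<inter> hyp f j) = Suc (codim X)"
proof -
  obtain y where y: "y \<in> X" "f j y \<noteq> 0"
    using assms by (auto simp: hyp_def)
  let ?K = "X \<inter> hyp f j"
  have sX: "vec.subspace X" and sK: "vec.subspace ?K"
    using assms inter_hyp_in_intersections by (auto intro: subspace_intersection)
  then have spK: "vec.span ?K = ?K" by (simp only: vec.span_eq_iff)
  have "X \<subseteq> vec.span (insert y ?K)"
  proof
    fix x assume x: "x \<in> X"
    \<comment> \<open>This coefficient makes \<open>f j\<close> vanish on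
      \<open>x - ?c *s y\<close>.\<close>
    let ?c = "f j x / f j y"
    have "x - ?c *s y \<in> X"
      using x y sX by (simp add: vec.subspace_diff vec.subspace_scale)
    moreover have "f j (x - ?c *s y) = 0"
      using f_add[OF j, of "x - ?c *s y" "?c *s y"] y(2) by (simp add: f_scale[OF j])
    ultimately have "x - ?c *s y \<in> vec.span ?K"
      by (intro vec.span_base) (auto simp: hyp_def)
    then show "x \<in> vec.span (insert y ?K)"
      unfolding vec.span_breakdown_eq ..
  qed
  then have "vec.dim X \<le> vec.dim (insert y ?K)"
    by (metis vec.dim_span vec.dim_subset)
  moreover have "vec.dim (insert y ?K) \<le> vec.dim X"
    using y by (intro vec.dim_subset) auto
  moreover have "y \<notin> vec.span ?K"
    unfolding spK using y by (simp add: hyp_def)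
  ultimately have "vec.dim X = Suc (vec.dim ?K)"
    by (simp add: vec.dim_insert)
  moreover have "vec.dim X \<le> CARD('m)"
    by (rule dim_subset_UNIV_cart_gen)
  ultimately show ?thesis by (simp add: codim_def)
qed

lemma intersections_eqI:
  assumes "X \<in> intersections n f" "Y \<in> intersections n f" "X \<subseteq> Y" "codim X = codim Y"
  shows "X = Y"
proof (rule vec.subspace_dim_equal)
  \<comment> \<open>Codimension is a truncated difference; these bounds allow equality of dimensions
    to be recovered from it.\<close>
  have "vec.dim X \<le> CARD('m)" "vec.dim Y \<le> CARD('m)"
    by (rule dim_subset_UNIV_cart_gen)+
  with assms(4) show "vec.dim Y \<le> vec.dim X"
    by (simp add: codim_def)
qed (use assms in \<open>auto intro: subspace_intersection\<close>)

lemma codim_UNIV: "codim (UNIV :: (complex^'m) set) = 0"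
  unfolding codim_def by (metis vec.dim_eq_full vec.span_UNIV vec_dim_card diff_self_eq_0)

text \<open>\<open>X\<close> lies in \<open>Y \<inter> hyp f j\<close> and has the same codimension.
  Hence a cover of \<open>Y\<close> is determined by any hyperplane that contains it but not
  \<open>Y\<close>.\<close>

lemma inter_hyp_unique:
  assumes "X \<in> intersections n f" "Y \<in> intersections n f" "j \<le> n" "\<not> Y \<subseteq> hyp f j"
    "codim X = Suc (codim Y)" "X \<subseteq> Y" "X \<subseteq> hyp f j"
  shows "X = Y \<inter> hyp f j"
  using assms by (intro intersections_eqI) (auto simp: codim_inter_hyp inter_hyp_in_intersections)

section \<open>Basic properties of flags\<close>

lemma
  assumes "G \<in> flags n f"
  shows flag_nonempty: "G \<noteq> []"
    and flag_nth: "k < length G \<Longrightarrow> G ! k \<in> intersections n f"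
    and flag_codim: "k < length G \<Longrightarrow> codim (G ! k) = k"
    and flag_step: "Suc k < length G \<Longrightarrow> G ! Suc k \<subset> G ! k"
  using assms by (auto simp: flags_def)

lemma flag_first: "G \<in> flags n f \<Longrightarrow> G ! 0 = UNIV"
  by (intro intersections_eqI) (auto simp: flag_nonempty flag_nth flag_codim UNIV_in_intersections codim_UNIV)

lemma flag_antimono:
  assumes "G \<in> flags n f" "k \<le> l" "l < length G"
  shows "G ! l \<subseteq> G ! k"
  using assms(2,3)
proof (induction l rule: dec_induct)
  case (step l)
  then show ?case using flag_step[OF assms(1), of l] by auto
qed simp

text \<open>The codimension of the last space is one less than the number of entries, which bounds
  the length of a flag.\<close>

lemma finite_flags [simp]: "finite (flags n f)"
proof (rule finite_subset)
  show "flags n f \<subseteq> {G. set G \<subseteq> intersections n f \<and> length G \<le> CARD('m) + 1}"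
  proof
    fix G assume G: "G \<in> flags n f"
    have "length G - 1 = codim (G ! (length G - 1))"
      using flag_codim[OF G, of "length G - 1"] flag_nonempty[OF G] by simp
    also have "\<dots> \<le> CARD('m)" by (simp add: codim_def)
    finally show "G \<in> {G. set G \<subseteq> intersections n f \<and> length G \<le> CARD('m) + 1}"
      using flag_nth[OF G] by (auto simp: in_set_conv_nth)
  qed
qed (rule finite_lists_length_le, simp)

section \<open>Values of flags as determinants\<close>

definition contained :: "(complex^'m) set \<Rightarrow> nat \<Rightarrow> complex" where
  "contained X j = of_bool (X \<subseteq> hyp f j)"

text \<open>On a flag this is the indicator that the hyperplane \<open>j\<close> starts to contain
  the space in passing from index \<open>k\<close> to \<open>Suc k\<close>. As a difference it
  telescopes over \<open>k\<close> and splits linearly in the determinant.\<close>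

definition level :: "(complex^'m) set list \<Rightarrow> nat \<Rightarrow> nat \<Rightarrow> complex" where
  "level G j k = contained (G ! Suc k) j - contained (G ! k) j"

lemma level_eq_of_bool:
  assumes "G \<in> flags n f" "Suc k < length G"
  shows "level G j k = of_bool (G ! Suc k \<subseteq> hyp f j \<and> \<not> G ! k \<subseteq> hyp f j)"
  using flag_step[OF assms] by (auto simp: level_def contained_def)

text \<open>Each step of a flag is a cover. If a hyperplane enters at that step, the next space must
  be its intersection with the current one; conversely, the strict drop in a chain forces the next
  hyperplane to be new.\<close>

lemma flag_eq_chain_of_iff:
  assumes G: "G \<in> flags n f" and J: "set J \<subseteq> {..n}" and len: "length G = Suc (length J)"
    and \<tau>: "\<tau> permutes {..<length J}"
  shows "G = chain_of f J \<tau> \<longleftrightarrow> (\<forall>k<length J. level G (J ! \<tau> k) k = 1)"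
proof
  assume eq: "G = chain_of f J \<tau>"
  have nth: "G ! k = (\<Inter>i<k. hyp f (J ! \<tau> i))" if "k \<le> length J" for k
    using that by (subst eq) (simp add: chain_of_def nth_append del: upt_Suc)
  show "\<forall>k<length J. level G (J ! \<tau> k) k = 1"
  proof (intro allI impI)
    fix k assume k: "k < length J"
    then have "G ! Suc k = G ! k \<inter> hyp f (J ! \<tau> k)"
      by (auto simp: nth lessThan_Suc)
    moreover have "G ! Suc k \<subset> G ! k"
      using flag_step[OF G, of k] k len by simp
    ultimately show "level G (J ! \<tau> k) k = 1"
      using k len by (auto simp: level_eq_of_bool[OF G])
  qed
next
  assume L: "\<forall>k<length J. level G (J ! \<tau> k) k = 1"
  have nth: "G ! k = (\<Inter>i<k. hyp f (J ! \<tau> i))" if "k \<le> length J" for k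
    using that
  proof (induction k)
    case 0
    then show ?case by (simp add: flag_first[OF G])
  next
    case (Suc k)
    then have k: "k < length J" by simp
    have "\<tau> k < length J"
      using k \<tau> by (auto dest: permutes_in_image)
    then have "J ! \<tau> k \<le> n" using J nth_mem by fastforce
    moreover have "G ! Suc k \<subseteq> hyp f (J ! \<tau> k)" "\<not> G ! k \<subseteq> hyp f (J ! \<tau> k)"
      using L k len by (auto simp: level_eq_of_bool[OF G] split: if_splits)
    ultimately have "G ! Suc k = G ! k \<inter> hyp f (J ! \<tau> k)"
      using k len flag_step[OF G, of k]
      by (intro inter_hyp_unique) (auto simp: flag_nth[OF G] flag_codim[OF G])
    then show ?case using Suc by (auto simp: lessThan_Suc)
  qed
  show "G = chain_of f J \<tau>"
    by (rule nth_equalityI) (auto simp: len chain_of_def nth nth_append simp del: upt_Suc)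
qed

text \<open>Once a hyperplane contains a space of the flag it contains all later ones, so it enters
  at most once.\<close>

lemma level_unique:
  assumes "G \<in> flags n f" "Suc k < length G" "Suc l < length G" "level G j k = 1" "level G j l = 1"
  shows "k = l"
proof -
  have *: False if "k < l" "Suc l < length G" "level G j k = 1" "level G j l = 1" for k l
    using that flag_antimono[OF assms(1), of "Suc k" l]
    by (auto simp: level_eq_of_bool[OF assms(1)] split: if_splits)
  show ?thesis
    using assms *[of k l] *[of l k] by (cases k l rule: linorder_cases) auto
qed

lemma chain_of_inj:
  assumes G: "G \<in> flags n f" and J: "set J \<subseteq> {..n}" and len: "length G = Suc (length J)"
    and \<sigma>: "\<sigma> permutes {..<length J}" "G = chain_of f J \<sigma>"
    and \<tau>: "\<tau> permutes {..<length J}" "G = chain_of f J \<tau>"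
  shows "\<sigma> = \<tau>"
proof
  fix k
  show "\<sigma> k = \<tau> k"
  proof (cases "k < length J")
    case True
    \<comment> \<open>The step at which \<open>\<tau>\<close> uses the hyperplane that
      \<open>\<sigma>\<close> uses at step \<open>k\<close>. The hyperplane enters at both steps, so
      they agree.\<close>
    let ?l = "inv_into UNIV \<tau> (\<sigma> k)"
    have l: "\<tau> ?l = \<sigma> k" using \<tau>(1) by (simp add: permutes_inverses)
    have lt: "?l < length J"
      using True permutes_in_image[OF \<sigma>(1), of k] permutes_in_image[OF permutes_inv[OF \<tau>(1)], of "\<sigma> k"]
      by simp
    have "level G (J ! \<sigma> k) k = 1"
      using flag_eq_chain_of_iff[OF G J len \<sigma>(1)] \<sigma>(2) True by blast
    moreover have "level G (J ! \<tau> ?l) ?l = 1"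
      using flag_eq_chain_of_iff[OF G J len \<tau>(1)] \<tau>(2) lt by blast
    ultimately have "k = ?l"
      using True lt len l by (intro level_unique[OF G]) auto
    then show ?thesis using l by simp
  next
    case False
    then show ?thesis using \<sigma>(1) \<tau>(1) by (simp add: permutes_not_in)
  qed
qed

text \<open>Every product in the Leibniz formula is 0 or 1, and at most one is 1: the one whose
  inverse permutation describes \<open>G\<close> as a chain. A permutation and its inverse have the
  same sign.\<close>

lemma flag_eval_eq_fdet:
  assumes G: "G \<in> flags n f" and J: "set J \<subseteq> {..n}"
  shows "flag_eval f G J =
    (if length G = Suc (length J) then fdet (length J) (\<lambda>i. level G (J ! i)) else 0)"
proof (cases "length G = Suc (length J)")
  case False
  then have "\<And>\<sigma>. G \<noteq> chain_of f J \<sigma>" by (auto simp: chain_of_def)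
  then show ?thesis using False by (simp add: flag_eval_def)
next
  case len: True
  let ?p = "length J"
  have prod_level: "(\<Prod>i<?p. level G (J ! i) (\<sigma> i)) = of_bool (G = chain_of f J (inv_into UNIV \<sigma>))"
    if \<sigma>: "\<sigma> permutes {..<?p}" for \<sigma>
  proof -
    have lt: "\<sigma> i < ?p" if "i < ?p" for i
      using \<sigma> that by (auto dest: permutes_in_image)
    have "(\<Prod>i<?p. level G (J ! i) (\<sigma> i)) = of_bool (\<forall>i<?p. level G (J ! i) (\<sigma> i) = 1)"
    proof (cases "\<forall>i<?p. level G (J ! i) (\<sigma> i) = 1")
      case False
      then obtain i where "i < ?p" "level G (J ! i) (\<sigma> i) = 0"
        using lt len by (auto simp: level_eq_of_bool[OF G])
      then show ?thesis using False by (auto intro!: prod_zero)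
    qed simp
    \<comment> \<open>The Leibniz formula sends positions in \<open>J\<close> to steps of the flag,
      while \<open>chain_of\<close> sends steps to positions; hence the inverse.\<close>
    also have "(\<forall>i<?p. level G (J ! i) (\<sigma> i) = 1) \<longleftrightarrow> (\<forall>k<?p. level G (J ! inv_into UNIV \<sigma> k) k = 1)"
      using \<sigma> lt by (metis lessThan_iff permutes_in_image permutes_inv permutes_inverses)
    also have "\<dots> \<longleftrightarrow> G = chain_of f J (inv_into UNIV \<sigma>)"
      by (rule flag_eq_chain_of_iff[OF G J len permutes_inv[OF \<sigma>], symmetric])
    finally show ?thesis .
  qed
  have det: "fdet ?p (\<lambda>i. level G (J ! i)) =
      (\<Sum>\<sigma> | \<sigma> permutes {..<?p}. of_int (sign \<sigma>) * of_bool (G = chain_of f J (inv_into UNIV \<sigma>)))"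
    unfolding fdet_leibniz by (intro sum.cong refl) (simp add: prod_level)
  show ?thesis
  proof (cases "\<exists>\<tau>. \<tau> permutes {..<?p} \<and> G = chain_of f J \<tau>")
    case True
    then obtain \<tau> where \<tau>: "\<tau> permutes {..<?p}" "G = chain_of f J \<tau>" by blast
    have the: "(THE \<sigma>. \<sigma> permutes {..<?p} \<and> G = chain_of f J \<sigma>) = \<tau>"
      using \<tau> chain_of_inj[OF G J len] by (intro the_equality) auto
    have "(\<Sum>\<sigma> | \<sigma> permutes {..<?p}. of_int (sign \<sigma>) * of_bool (G = chain_of f J (inv_into UNIV \<sigma>))) =
        (\<Sum>\<sigma>\<in>{inv_into UNIV \<tau>}. of_int (sign \<sigma>) * of_bool (G = chain_of f J (inv_into UNIV \<sigma>)) :: complex)"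
    proof (rule sum.mono_neutral_right)
      show "\<forall>\<sigma>\<in>{\<sigma>. \<sigma> permutes {..<?p}} - {inv_into UNIV \<tau>}.
          of_int (sign \<sigma>) * of_bool (G = chain_of f J (inv_into UNIV \<sigma>)) = (0::complex)"
      proof
        fix \<sigma> assume \<sigma>: "\<sigma> \<in> {\<sigma>. \<sigma> permutes {..<?p}} - {inv_into UNIV \<tau>}"
        then have "G \<noteq> chain_of f J (inv_into UNIV \<sigma>)"
          using chain_of_inj[OF G J len permutes_inv _ \<tau>, of \<sigma>] permutes_inv_inv[of \<sigma>] by auto
        then show "of_int (sign \<sigma>) * of_bool (G = chain_of f J (inv_into UNIV \<sigma>)) = (0::complex)"
          by simp
      qed
    qed (auto simp: finite_permutations permutes_inv[OF \<tau>(1)])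
    also have "\<dots> = of_int (sign \<tau>)"
      using \<tau> by (simp add: permutes_inv_inv sign_inverse permutes_imp_permutation[of "{..<?p}"])
    finally show ?thesis
      using True len by (simp add: flag_eval_def the det)
  next
    case False
    have "(\<Sum>\<sigma> | \<sigma> permutes {..<?p}. of_int (sign \<sigma>) * of_bool (G = chain_of f J (inv_into UNIV \<sigma>))) = (0::complex)"
      using False by (intro sum.neutral) (auto dest: permutes_inv)
    moreover have "flag_eval f G J = 0"
      unfolding flag_eval_def if_not_P[OF False] ..
    ultimately show ?thesis by (simp add: len det)
  qed
qed


section \<open>The pairing as a limit\<close>

text \<open>The forms that do not vanish on \<open>X\<close> are treated one at a time. A vector
  good for the earlier ones is moved along a line on which only finitely many parameters are bad,
  and the field is infinite.\<close>

lemma generic_point: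
  assumes X: "X \<in> intersections n f"
  obtains w where "w \<in> X" "\<And>j. j \<le> n \<Longrightarrow> f j w = 0 \<longleftrightarrow> X \<subseteq> hyp f j"
proof -
  have sX: "vec.subspace X" by (rule subspace_intersection[OF X])
  have "\<exists>w\<in>X. \<forall>j\<in>T. f j w \<noteq> 0" if "finite T" "T \<subseteq> {j. j \<le> n \<and> \<not> X \<subseteq> hyp f j}" for T
    using that
  proof (induction T rule: finite_induct)
    case empty
    then show ?case using vec.subspace_0[OF sX] by auto
  next
    case (insert j T)
    then obtain w where w: "w \<in> X" "\<forall>i\<in>T. f i w \<noteq> 0" by auto
    obtain y where y: "y \<in> X" "f j y \<noteq> 0"
      using insert.prems by (auto simp: hyp_def)
    \<comment> \<open>Where \<open>f i y = 0\<close> the quotient is 0 by convention. Such an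
      \<open>i\<close> lies in \<open>T\<close>, and \<open>f i\<close> keeps its nonzero value
      \<open>f i w\<close> along the line.\<close>
    let ?bad = "(\<lambda>i. - f i w / f i y) ` insert j T"
    obtain t where t: "t \<notin> ?bad"
      using ex_new_if_finite[of ?bad] infinite_UNIV_char_0 insert.hyps(1) by blast
    have "f i (w + t *s y) \<noteq> 0" if i: "i \<in> insert j T" for i
    proof
      assume 0: "f i (w + t *s y) = 0"
      have "f i w + t * f i y = 0"
        using 0 i insert.prems f_add[of i w "t *s y"] f_scale[of i t y] by auto
      moreover have "f i y \<noteq> 0"
        using calculation i w y by auto
      ultimately have "t = - f i w / f i y"
        by (simp add: field_simps add_eq_0_iff)
      then show False using t i by blast
    qed
    then show ?case
      using w(1) y(1) sX by (intro bexI[of _ "w + t *s y"]) (auto simp: vec.subspace_add vec.subspace_scale)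
  qed
  from this[of "{j. j \<le> n \<and> \<not> X \<subseteq> hyp f j}"]
  obtain w where "w \<in> X" "\<And>j. j \<le> n \<Longrightarrow> \<not> X \<subseteq> hyp f j \<Longrightarrow> f j w \<noteq> 0" by auto
  then show ?thesis by (intro that[of w]) (auto simp: hyp_def)
qed

text \<open>With \<open>w\<^sub>k\<close> generic in the \<open>k\<close>-th space of a flag of length \<open>p\<close>, take
  \<open>x = \<Sum>\<^sub>k \<epsilon>\<^bsup>p-k\<^esup> w\<^sub>k\<close> and \<open>v\<^sub>k = \<epsilon>\<^bsup>p-k\<^esup> w\<^sub>k\<close>. If \<open>m\<close> is the last index with \<open>f\<^sub>j (w\<^sub>m) \<noteq> 0\<close>, then
  \<open>f\<^sub>j (x)\<close> has leading term \<open>\<epsilon>\<^bsup>p-m\<^esup> f\<^sub>j (w\<^sub>m)\<close>, so \<open>f\<^sub>j (v\<^sub>k) / f\<^sub>j (x)\<close> tends to \<open>1\<close> for \<open>k = m\<close> and to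
  \<open>0\<close> otherwise.\<close>

lemma flag_eval_limit:
  assumes G: "G \<in> flags n f"
  obtains x :: "complex \<Rightarrow> complex^'m" and vs
    where "\<And>J. set J \<subseteq> {..n} \<Longrightarrow>
      ((\<lambda>\<epsilon>. omega_mono n f J (x \<epsilon>) (vs \<epsilon>)) \<longlongrightarrow> flag_eval f G J) (at 0)"
proof -
  define p where "p = length G - 1"
  have len: "length G = Suc p" using flag_nonempty[OF G] by (simp add: p_def)
  define w where "w k = (SOME w. \<forall>j\<le>n. f j w = 0 \<longleftrightarrow> G ! k \<subseteq> hyp f j)" for k
  have w: "f j (w k) = 0 \<longleftrightarrow> G ! k \<subseteq> hyp f j" if "k \<le> p" "j \<le> n" for k j
  proof -
    have "G ! k \<in> intersections n f" using flag_nth[OF G, of k] that len by simp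
    then have "\<exists>w. \<forall>j\<le>n. f j w = 0 \<longleftrightarrow> G ! k \<subseteq> hyp f j" by (rule generic_point) blast
    then have "\<forall>j\<le>n. f j (w k) = 0 \<longleftrightarrow> G ! k \<subseteq> hyp f j" unfolding w_def by (rule someI_ex)
    then show ?thesis using that(2) by blast
  qed
  \<comment> \<open>The sum includes \<open>i = p\<close>, although there are only \<open>p\<close>
    vectors. For a hyperplane not containing the last space this term gives
    \<open>f j (x \<epsilon>)\<close> a nonzero limit, while every vector carries a positive power
    of \<open>\<epsilon>\<close>.\<close>
  define x where "x \<epsilon> = (\<Sum>i\<le>p. \<epsilon> ^ (p - i) *s w i)" for \<epsilon>
  define vs where "vs \<epsilon> = map (\<lambda>k. \<epsilon> ^ (p - k) *s w k) [0..<p]" for \<epsilon>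
  have expand: "\<exists>m R. m \<le> p \<and> (\<forall>i\<le>p. G ! i \<subseteq> hyp f j \<longleftrightarrow> m < i) \<and>
      (\<forall>\<epsilon>. f j (x \<epsilon>) = \<epsilon> ^ (p - m) * R \<epsilon>) \<and> (R \<longlongrightarrow> f j (w m)) (at 0)" if j: "j \<le> n" for j
  proof -
    define m where "m = Max {i. i \<le> p \<and> \<not> G ! i \<subseteq> hyp f j}"
    have fin: "finite {i. i \<le> p \<and> \<not> G ! i \<subseteq> hyp f j}" by simp
    have ne: "0 \<in> {i. i \<le> p \<and> \<not> G ! i \<subseteq> hyp f j}"
      using not_UNIV_subset_hyp[OF j] by (simp add: flag_first[OF G])
    have m: "m \<le> p" "\<not> G ! m \<subseteq> hyp f j"
      using Max_in[OF fin] ne unfolding m_def by blast+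
    have mi: "G ! i \<subseteq> hyp f j \<longleftrightarrow> m < i" if "i \<le> p" for i
    proof
      assume "m < i"
      show "G ! i \<subseteq> hyp f j"
      proof (rule ccontr)
        assume "\<not> G ! i \<subseteq> hyp f j"
        then have "i \<le> m" unfolding m_def using that by (intro Max_ge[OF fin]) simp
        with \<open>m < i\<close> show False by simp
      qed
    next
      assume *: "G ! i \<subseteq> hyp f j"
      show "m < i"
      proof (rule ccontr)
        assume "\<not> m < i"
        then have "G ! m \<subseteq> G ! i" using m(1) len by (intro flag_antimono[OF G]) auto
        from this * have "G ! m \<subseteq> hyp f j" by (rule order_trans)
        with m(2) show False by (rule notE)
      qed
    qed
    \<comment> \<open>The value of \<open>f j\<close> at \<open>x \<epsilon>\<close> after removal
      of the power of \<open>\<epsilon>\<close>; terms with \<open>i > m\<close> are absent because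
      \<open>f j (w i) = 0\<close> there.\<close>
    define R where "R \<epsilon> = (\<Sum>i\<le>m. \<epsilon> ^ (m - i) * f j (w i))" for \<epsilon>
    have fx: "f j (x \<epsilon>) = \<epsilon> ^ (p - m) * R \<epsilon>" for \<epsilon>
    proof -
      have "f j (x \<epsilon>) = (\<Sum>i\<le>p. \<epsilon> ^ (p - i) * f j (w i))"
        by (simp add: x_def f_sum[OF j] f_scale[OF j])
      also have "\<dots> = (\<Sum>i\<le>m. \<epsilon> ^ (p - i) * f j (w i))"
        using m(1) w[OF _ j] mi by (intro sum.mono_neutral_right) auto
      also have "\<dots> = \<epsilon> ^ (p - m) * R \<epsilon>"
        unfolding R_def sum_distrib_left mult.assoc[symmetric] power_add[symmetric]
        using m(1) by (intro sum.cong) simp_all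
      finally show ?thesis .
    qed
    have "(R \<longlongrightarrow> (\<Sum>i\<le>m. 0 ^ (m - i) * f j (w i))) (at 0)"
      unfolding R_def by (intro tendsto_intros)
    \<comment> \<open>Since \<open>0 ^ 0 = 1\<close>, exactly the term \<open>i = m\<close>
      survives.\<close>
    moreover have "(\<Sum>i\<le>m. 0 ^ (m - i) * f j (w i)) = f j (w m)"
    proof -
      have "(\<Sum>i\<le>m. 0 ^ (m - i) * f j (w i)) = (\<Sum>i\<in>{m}. 0 ^ (m - i) * f j (w i))"
        by (intro sum.mono_neutral_right) auto
      then show ?thesis by simp
    qed
    ultimately show ?thesis
      using m(1) mi fx by (intro exI[of _ m] exI[of _ R]) simp
  qed
  have entry: "((\<lambda>\<epsilon>. f j (vs \<epsilon> ! k) / f j (x \<epsilon>)) \<longlongrightarrow> level G j k) (at 0)"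
    if j: "j \<le> n" and k: "k < p" for j k
  proof -
    obtain m R where m: "m \<le> p" "\<forall>i\<le>p. G ! i \<subseteq> hyp f j \<longleftrightarrow> m < i"
      and R: "\<forall>\<epsilon>. f j (x \<epsilon>) = \<epsilon> ^ (p - m) * R \<epsilon>" "(R \<longlongrightarrow> f j (w m)) (at 0)"
      using expand[OF j] by (elim exE conjE) (rule that)
    note m = m[rule_format] and R = R[rule_format]
    have wm: "f j (w m) \<noteq> 0" using w[OF m(1) j] m(2)[OF m(1)] by simp
    \<comment> \<open>For \<open>m < p\<close> the hyperplane enters between the spaces
      \<open>m\<close> and \<open>Suc m\<close>; for \<open>m = p\<close> it never enters, and no
      \<open>k < p\<close> equals \<open>m\<close>.\<close>
    have lev: "level G j k = of_bool (k = m)"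
      using k len m(2)[of k] m(2)[of "Suc k"] by (auto simp: level_eq_of_bool[OF G])
    have num: "f j (vs \<epsilon> ! k) = \<epsilon> ^ (p - k) * f j (w k)" for \<epsilon>
      using k by (simp add: vs_def f_scale[OF j])
    show ?thesis
    proof (cases "m < k")
      case True
      then have "f j (w k) = 0" using w[of k j] m(2)[of k] j k by simp
      then show ?thesis using True by (simp add: num lev)
    next
      case False
      have "((\<lambda>\<epsilon>. \<epsilon> ^ (m - k) * f j (w k) / R \<epsilon>) \<longlongrightarrow> 0 ^ (m - k) * f j (w k) / f j (w m)) (at 0)"
        using wm by (intro tendsto_intros R)
      moreover have "0 ^ (m - k) * f j (w k) / f j (w m) = level G j k"
        unfolding lev using False wm by (cases "k = m") auto
      ultimately have "((\<lambda>\<epsilon>. \<epsilon> ^ (m - k) * f j (w k) / R \<epsilon>) \<longlongrightarrow> level G j k) (at 0)"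
        by simp
      moreover have "eventually (\<lambda>\<epsilon>. \<epsilon> ^ (m - k) * f j (w k) / R \<epsilon> = f j (vs \<epsilon> ! k) / f j (x \<epsilon>)) (at 0)"
        unfolding eventually_at_filter
      proof (intro always_eventually allI impI)
        fix \<epsilon> :: complex assume "\<epsilon> \<noteq> 0"
        moreover have "p - k = (p - m) + (m - k)" using False m(1) by simp
        ultimately show "\<epsilon> ^ (m - k) * f j (w k) / R \<epsilon> = f j (vs \<epsilon> ! k) / f j (x \<epsilon>)"
          by (simp add: num R(1) power_add)
      qed
      ultimately show ?thesis
        by (rule Lim_transform_eventually)
    qed
  qed
  have "eventually (\<lambda>\<epsilon>. f j (x \<epsilon>) \<noteq> 0) (at 0)" if j: "j \<le> n" for j
  proof -
    obtain m R where m: "m \<le> p" "\<forall>i\<le>p. G ! i \<subseteq> hyp f j \<longleftrightarrow> m < i"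
      and R: "\<forall>\<epsilon>. f j (x \<epsilon>) = \<epsilon> ^ (p - m) * R \<epsilon>" "(R \<longlongrightarrow> f j (w m)) (at 0)"
      using expand[OF j] by (elim exE conjE) (rule that)
    note m = m[rule_format] and R = R[rule_format]
    have "f j (w m) \<noteq> 0" using w[OF m(1) j] m(2)[OF m(1)] by simp
    then have "eventually (\<lambda>\<epsilon>. R \<epsilon> \<noteq> 0) (at 0)"
      using R(2) by (rule tendsto_imp_eventually_ne[rotated])
    moreover have "eventually (\<lambda>\<epsilon>::complex. \<epsilon> \<noteq> 0) (at 0)"
      by (simp add: eventually_at_filter)
    ultimately show ?thesis by eventually_elim (simp add: R(1))
  qed
  then have "eventually (\<lambda>\<epsilon>. \<forall>j\<in>{..n}. f j (x \<epsilon>) \<noteq> 0) (at 0)"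
    by (intro eventually_ball_finite) auto
  then have compl: "eventually (\<lambda>\<epsilon>. x \<epsilon> \<in> arr_complement n f) (at 0)"
    by eventually_elim (auto simp: arr_complement_def hyp_def)
  show ?thesis
  proof (rule that)
    fix J assume J: "set J \<subseteq> {..n}"
    show "((\<lambda>\<epsilon>. omega_mono n f J (x \<epsilon>) (vs \<epsilon>)) \<longlongrightarrow> flag_eval f G J) (at 0)"
    proof (cases "length J = p")
      case True
      have "((\<lambda>\<epsilon>. fdet p (\<lambda>i k. f (J ! i) (vs \<epsilon> ! k) / f (J ! i) (x \<epsilon>))) \<longlongrightarrow>
          fdet p (\<lambda>i k. level G (J ! i) k)) (at 0)"
        using J True by (intro tendsto_fdet entry) (auto simp: set_conv_nth)
      moreover have "eventually (\<lambda>\<epsilon>. fdet p (\<lambda>i k. f (J ! i) (vs \<epsilon> ! k) / f (J ! i) (x \<epsilon>)) =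
          omega_mono n f J (x \<epsilon>) (vs \<epsilon>)) (at 0)"
        using compl by eventually_elim (simp add: omega_mono_eq_fdet True vs_def)
      ultimately have "((\<lambda>\<epsilon>. omega_mono n f J (x \<epsilon>) (vs \<epsilon>)) \<longlongrightarrow>
          fdet p (\<lambda>i k. level G (J ! i) k)) (at 0)"
        by (rule Lim_transform_eventually)
      then show ?thesis
        by (simp add: flag_eval_eq_fdet[OF G J] True len)
    next
      case False
      then have "omega_mono n f J (x \<epsilon>) (vs \<epsilon>) = 0" for \<epsilon>
        by (simp add: omega_mono_eq_fdet vs_def)
      then show ?thesis using False by (simp add: flag_eval_eq_fdet[OF G J] len)
    qed
  qed
qed

text \<open>Monomials satisfy linear relations, so the coefficients of a form are not unique. The
  value on a flag is nevertheless a limit of values of the form itself.\<close>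

lemma flag_eval_well_defined:
  assumes G: "G \<in> flags n f"
    and eq: "(\<lambda>x vs. \<Sum>J\<in>increasing_tuples n. b J * omega_mono n f J x vs) =
      (\<lambda>x vs. \<Sum>J\<in>increasing_tuples n. b' J * omega_mono n f J x vs)"
  shows "(\<Sum>J\<in>increasing_tuples n. b J * flag_eval f G J) =
    (\<Sum>J\<in>increasing_tuples n. b' J * flag_eval f G J)"
proof (rule flag_eval_limit[OF G])
  fix x :: "complex \<Rightarrow> complex^'m" and vs
  assume lim: "\<And>J. set J \<subseteq> {..n} \<Longrightarrow>
      ((\<lambda>\<epsilon>. omega_mono n f J (x \<epsilon>) (vs \<epsilon>)) \<longlongrightarrow> flag_eval f G J) (at 0)"
  have "((\<lambda>\<epsilon>. \<Sum>J\<in>increasing_tuples n. b J * omega_mono n f J (x \<epsilon>) (vs \<epsilon>)) \<longlongrightarrow>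
      (\<Sum>J\<in>increasing_tuples n. b J * flag_eval f G J)) (at 0)" for b
    by (intro tendsto_intros lim) (simp add: increasing_tuples_def)
  from this[of b] this[of b'] show ?thesis
    unfolding fun_cong[OF fun_cong[OF eq]] by (rule tendsto_unique[rotated]) simp
qed


section \<open>Relators and the flag differential\<close>

lemma contained_diff_cover:
  assumes Y: "Y \<in> intersections n f" and j: "j \<le> n" and X: "X \<in> intersections n f" "X \<subset> Y"
    "codim X = Suc (codim Y)"
  shows "contained X j - contained Y j = of_bool (\<not> Y \<subseteq> hyp f j \<and> X = Y \<inter> hyp f j)"
proof (cases "Y \<subseteq> hyp f j")
  case True
  then have "X \<subseteq> hyp f j" using X(2) by blast
  with True show ?thesis by (simp add: contained_def)
next
  case False
  have "X \<subseteq> hyp f j \<longleftrightarrow> X = Y \<inter> hyp f j"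
    using inter_hyp_unique[OF X(1) Y j False X(3)] X(2) by blast
  with False show ?thesis by (simp add: contained_def)
qed

text \<open>If the hyperplane does not contain \<open>Y\<close>, exactly one cover of
  \<open>Y\<close> lies in it, namely the intersection; otherwise all differences vanish.\<close>

lemma sum_contained_covers:
  assumes Y: "Y \<in> intersections n f" and j: "j \<le> n"
  shows "(\<Sum>X | X \<in> intersections n f \<and> X \<subset> Y \<and> codim X = Suc (codim Y).
    contained X j - contained Y j) = 1 - contained Y j"
proof -
  let ?T = "{X. X \<in> intersections n f \<and> X \<subset> Y \<and> codim X = Suc (codim Y)}"
  have "(\<Sum>X\<in>?T. contained X j - contained Y j) =
      (\<Sum>X\<in>?T. if X = Y \<inter> hyp f j then of_bool (\<not> Y \<subseteq> hyp f j) else 0)"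
    by (intro sum.cong refl, subst contained_diff_cover[OF Y j]) auto
  also have "\<dots> = (if Y \<inter> hyp f j \<in> ?T then of_bool (\<not> Y \<subseteq> hyp f j) else 0)"
    by (rule sum.delta) simp
  also have "\<dots> = 1 - contained Y j"
    using codim_inter_hyp[OF Y j] inter_hyp_in_intersections[OF Y j] by (auto simp: contained_def)
  finally show ?thesis .
qed

text \<open>The only possible contribution comes from \<open>X = Y \<inter> hyp f j\<close>, which
  is available exactly when the hyperplane contains \<open>Z\<close> but not
  \<open>Y\<close>.\<close>

lemma sum_contained_between:
  assumes Y: "Y \<in> intersections n f" and j: "j \<le> n"
    and Z: "Z \<in> intersections n f" "Z \<subset> Y" "codim Z = Suc (Suc (codim Y))"
  shows "(\<Sum>X | X \<in> intersections n f \<and> X \<subset> Y \<and> Z \<subset> X \<and> codim X = Suc (codim Y).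
    contained X j - contained Y j) = contained Z j - contained Y j"
proof -
  let ?T = "{X. X \<in> intersections n f \<and> X \<subset> Y \<and> Z \<subset> X \<and> codim X = Suc (codim Y)}"
  have "(\<Sum>X\<in>?T. contained X j - contained Y j) =
      (\<Sum>X\<in>?T. if X = Y \<inter> hyp f j then of_bool (\<not> Y \<subseteq> hyp f j) else 0)"
    by (intro sum.cong refl, subst contained_diff_cover[OF Y j]) auto
  also have "\<dots> = (if Y \<inter> hyp f j \<in> ?T then of_bool (\<not> Y \<subseteq> hyp f j) else 0)"
    by (rule sum.delta) simp
  also have "\<dots> = contained Z j - contained Y j"
  proof (cases "Y \<subseteq> hyp f j")
    case True
    then show ?thesis using Z(2) by (auto simp: contained_def)
  next
    case False
    \<comment> \<open>The codimensions differ, so containment of \<open>Z\<close> in the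
      intersection is strict.\<close>
    have "Z \<noteq> Y \<inter> hyp f j"
      using Z(3) codim_inter_hyp[OF Y j False] by auto
    then have "Y \<inter> hyp f j \<in> ?T \<longleftrightarrow> Z \<subseteq> hyp f j"
      using False Z(2) codim_inter_hyp[OF Y j] inter_hyp_in_intersections[OF Y j] by auto
    then show ?thesis using False by (simp add: contained_def)
  qed
  finally show ?thesis .
qed

section \<open>Pairing of representatives with monomials\<close>

definition pair :: "((complex^'m) set list \<Rightarrow> complex) \<Rightarrow> nat list \<Rightarrow> complex" where
  "pair c J = (\<Sum>G\<in>flags n f. c G * flag_eval f G J)"

lemma pair_flag_vec: "G \<in> flags n f \<Longrightarrow> pair (flag_vec G) J = flag_eval f G J"
proof -
  assume "G \<in> flags n f"
  then have "(\<Sum>G'\<in>flags n f. if G' = G then flag_eval f G' J else 0) = flag_eval f G J"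
    by (subst sum.delta) simp_all
  moreover have "pair (flag_vec G) J = (\<Sum>G'\<in>flags n f. if G' = G then flag_eval f G' J else 0)"
    unfolding pair_def flag_vec_def by (intro sum.cong) simp_all
  ultimately show ?thesis by simp
qed

lemma pair_sum: "pair (\<Sum>a\<in>A. g a) J = (\<Sum>a\<in>A. pair (g a) J)"
  unfolding pair_def sum_fun_apply by (subst sum.swap) (simp add: sum_distrib_right)

text \<open>Covers both uses: inserting a space as in the relators and, with \<open>Zs = []\<close>,
  extending a flag at its end as in the differential.\<close>

lemma append_flag:
  assumes Ys: "Ys \<in> flags n f"
    and X: "X \<in> intersections n f" "X \<subset> last Ys" "codim X = length Ys"
    and Zs: "Zs \<noteq> [] \<Longrightarrow> hd Zs \<subset> X"
      "\<forall>k<length Zs. Zs ! k \<in> intersections n f \<and> codim (Zs ! k) = length Ys + 1 + k"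
      "\<forall>k. Suc k < length Zs \<longrightarrow> Zs ! Suc k \<subset> Zs ! k"
  shows "Ys @ X # Zs \<in> flags n f"
proof -
  let ?G = "Ys @ X # Zs"
  have ne: "Ys \<noteq> []" by (rule flag_nonempty[OF Ys])
  have "?G ! k \<in> intersections n f \<and> codim (?G ! k) = k" if "k < length ?G" for k
  proof (cases k "length Ys" rule: linorder_cases)
    case less
    then show ?thesis by (simp add: nth_append flag_nth[OF Ys] flag_codim[OF Ys])
  next
    case equal
    then show ?thesis using X by (simp add: nth_append)
  next
    case greater
    then obtain l where "k = Suc (length Ys + l)" using less_iff_Suc_add by auto
    then show ?thesis using Zs(2) that by (simp add: nth_append)
  qed
  moreover have "?G ! Suc k \<subset> ?G ! k" if "Suc k < length ?G" for k
  proof -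
    consider "Suc k < length Ys" | "Suc k = length Ys" | "k = length Ys" | "length Ys < k"
      by linarith
    then show ?thesis
    proof cases
      case 1
      then show ?thesis by (simp add: nth_append flag_step[OF Ys])
    next
      case 2
      then have "last Ys = Ys ! k" using ne by (metis diff_Suc_1 last_conv_nth)
      then show ?thesis using 2 X(2) by (simp add: nth_append)
    next
      case 3
      then have "Zs \<noteq> []" using that by auto
      then show ?thesis using 3 Zs(1) by (simp add: nth_append hd_conv_nth)
    next
      case 4
      then obtain l where "k = Suc (length Ys + l)" using less_iff_Suc_add by auto
      then show ?thesis using Zs(3) that by (simp add: nth_append)
    qed
  qed
  ultimately show ?thesis unfolding flags_def by simp
qed

text \<open>The middle space \<open>X\<close> affects only two neighbouring columns, and their sum
  does not depend on it. After adding one to the other, summation over \<open>X\<close> makes the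
  two columns equal.\<close>

lemma pair_relator:
  assumes r: "r \<in> flag_relators n f" and J: "set J \<subseteq> {..n}"
  shows "pair r J = 0"
proof -
  obtain Ys Zs where Ys: "Ys \<in> flags n f" and Zs: "Zs \<noteq> []" "hd Zs \<subset> last Ys"
      "\<forall>k<length Zs. Zs ! k \<in> intersections n f \<and> codim (Zs ! k) = length Ys + 1 + k"
      "\<forall>k. Suc k < length Zs \<longrightarrow> Zs ! Suc k \<subset> Zs ! k"
    and r: "r = (\<Sum>X | X \<in> intersections n f \<and> X \<subset> last Ys \<and> hd Zs \<subset> X \<and> codim X = length Ys.
         flag_vec (Ys @ X # Zs))"
    using r unfolding flag_relators_def by blast
  define Y where "Y = last Ys"
  define Z where "Z = hd Zs"
  define T where "T = {X. X \<in> intersections n f \<and> X \<subset> Y \<and> Z \<subset> X \<and> codim X = length Ys}"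
  define c where "c = length Ys - 1"
  have c: "length Ys = Suc c" using flag_nonempty[OF Ys] by (simp add: c_def)
  have Y_nth: "Y = Ys ! c" using c by (simp add: Y_def last_conv_nth[OF flag_nonempty[OF Ys]])
  have Z_nth: "Z = Zs ! 0" using Zs(1) by (simp add: Z_def hd_conv_nth)
  have Y: "Y \<in> intersections n f" "codim Y = c"
    using c by (auto simp: Y_nth flag_nth[OF Ys] flag_codim[OF Ys])
  have Z: "Z \<in> intersections n f" "Z \<subset> Y" "codim Z = Suc (Suc (codim Y))"
    using Zs c Y(2) by (auto simp: Z_nth[symmetric] Z_def[symmetric] Y_def[symmetric])
  have fl: "Ys @ X # Zs \<in> flags n f" if "X \<in> T" for X
    using that Zs by (intro append_flag[OF Ys]) (auto simp: T_def Y_def Z_def)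
  have pr: "pair r J = (\<Sum>X\<in>T. flag_eval f (Ys @ X # Zs) J)"
    unfolding r pair_sum Y_def[symmetric] Z_def[symmetric] T_def[symmetric]
    by (intro sum.cong refl pair_flag_vec fl)
  show ?thesis
  proof (cases "length J = length Ys + length Zs")
    case False
    then show ?thesis
      unfolding pr by (intro sum.neutral ballI) (simp add: flag_eval_eq_fdet[OF fl J])
  next
    case len: True
    define p where "p = length J"
    have p: "c < p" "Suc c < p" using len c Zs(1) by (auto simp: p_def neq_Nil_conv)
    \<comment> \<open>\<open>UNIV\<close> is a placeholder for the middle space; the two columns
      that it affects are overwritten below.\<close>
    define h where "h i = level (Ys @ UNIV # Zs) (J ! i)" for i
    define g where "g X i = contained X (J ! i) - contained Y (J ! i)" for X i
    have ev: "flag_eval f (Ys @ X # Zs) J = fdet p (\<lambda>i. (h i)(Suc c := g Z i, c := g X i))"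
      if X: "X \<in> T" for X
    proof -
      have lev: "level (Ys @ X # Zs) (J ! i) k = ((h i)(c := g X i, Suc c := g Z i - g X i)) k" for i k
        using c by (auto simp: level_def h_def g_def nth_append Y_nth Z_nth nth_Cons split: nat.splits)
      have "flag_eval f (Ys @ X # Zs) J =
          fdet p (\<lambda>i. (h i)(c := g X i, Suc c := g Z i - g X i))"
        unfolding flag_eval_eq_fdet[OF fl[OF X] J] p_def using len
        by (auto simp: lev intro!: fdet_cong)
      \<comment> \<open>Column \<open>Suc c\<close> is a difference whose second part repeats column
        \<open>c\<close>.\<close>
      also have "\<dots> = fdet p (\<lambda>i. (h i)(c := g X i, Suc c := g Z i)) -
          fdet p (\<lambda>i. (h i)(c := g X i, Suc c := g X i))"
        by (rule fdet_column_diff[OF p(2)])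
      also have "fdet p (\<lambda>i. (h i)(c := g X i, Suc c := g X i)) = 0"
        by (rule fdet_equal_columns[OF p]) auto
      \<comment> \<open>The updates are exchanged so that the sum over \<open>X\<close> can be moved
        into column \<open>c\<close>.\<close>
      also have "fdet p (\<lambda>i. (h i)(c := g X i, Suc c := g Z i)) - 0 =
          fdet p (\<lambda>i. (h i)(Suc c := g Z i, c := g X i))"
        unfolding diff_zero by (rule fdet_cong) simp
      finally show ?thesis .
    qed
    have "pair r J = fdet p (\<lambda>i. (h i)(Suc c := g Z i, c := \<Sum>X\<in>T. g X i))"
      unfolding pr fdet_column_sum[OF p(1)] by (intro sum.cong refl ev)
    also have "\<dots> = 0"
    proof (rule fdet_equal_columns[OF p])
      fix i assume "i < p"
      then have "J ! i \<le> n" using nth_le[OF J] by (simp add: p_def)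
      then have "(\<Sum>X\<in>T. g X i) = g Z i"
        using sum_contained_between[OF Y(1) _ Z, of "J ! i"] by (simp add: T_def g_def c Y(2))
      then show "((h i)(Suc c := g Z i, c := \<Sum>X\<in>T. g X i)) c =
          ((h i)(Suc c := g Z i, c := \<Sum>X\<in>T. g X i)) (Suc c)" by simp
    qed simp
    finally show ?thesis .
  qed
qed

lemma pair_span_relators:
  assumes "c \<in> fun_vs.span (flag_relators n f)" and J: "set J \<subseteq> {..n}"
  shows "pair c J = 0"
proof -
  have "fun_vs.span (flag_relators n f) \<subseteq> {c. pair c J = 0}"
  proof (rule fun_vs.span_minimal)
    show "fun_vs.subspace {c. pair c J = 0}"
    proof (rule fun_vs.subspaceI)
      fix x y assume "x \<in> {c. pair c J = 0}" "y \<in> {c. pair c J = 0}"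
      then show "x + y \<in> {c. pair c J = 0}" by (simp add: pair_def algebra_simps sum.distrib)
    next
      fix x and t :: complex assume "x \<in> {c. pair c J = 0}"
      then show "(\<lambda>G. t * x G) \<in> {c. pair c J = 0}"
        by (simp add: pair_def mult.assoc sum_distrib_left[symmetric])
    qed (simp add: pair_def)
  qed (use pair_relator[OF _ J] in auto)
  then show ?thesis using assms(1) by blast
qed

lemma pair_flag_rel:
  assumes "(c, c') \<in> flag_rel n f" "set J \<subseteq> {..n}"
  shows "pair c' J = pair c J"
proof -
  have "pair (c - c') J = 0"
    using assms by (intro pair_span_relators) (auto simp: flag_rel_def)
  then show ?thesis by (simp add: pair_def algebra_simps sum_subtractf)
qed

text \<open>Only the last column depends on \<open>X\<close>. Summed over \<open>X\<close> it
  becomes 1 minus the sum of the earlier columns, so it may be replaced by a column of ones;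
  expanding along that column deletes one entry of \<open>J\<close> at a time.\<close>

lemma sum_flag_eval_extend:
  assumes G: "G \<in> flags n f" and J: "set J \<subseteq> {..n}"
  shows "(\<Sum>X | X \<in> intersections n f \<and> X \<subset> last G \<and> codim X = length G. flag_eval f (G @ [X]) J) =
    (\<Sum>k<length J. (-1) ^ (k + (length J - 1)) * flag_eval f G (drop_nth k J))"
proof -
  define T where "T = {X. X \<in> intersections n f \<and> X \<subset> last G \<and> codim X = length G}"
  define p where "p = length J"
  have fl: "G @ [X] \<in> flags n f" if "X \<in> T" for X
    using that by (intro append_flag[OF G]) (auto simp: T_def)
  have Jk: "set (drop_nth k J) \<subseteq> {..n}" for k
    using set_drop_nth_subset[of k J] J by blast
  show ?thesis
  proof (cases "length G = p")
    case False
    have "(\<Sum>X\<in>T. flag_eval f (G @ [X]) J) = 0"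
      using False by (intro sum.neutral ballI) (simp add: flag_eval_eq_fdet[OF fl J] p_def)
    moreover have "flag_eval f G (drop_nth k J) = 0" if "k < length J" for k
    proof -
      have "length G \<noteq> Suc (length (drop_nth k J))"
        using False that by (simp add: p_def)
      then show ?thesis by (simp add: flag_eval_eq_fdet[OF G Jk])
    qed
    ultimately show ?thesis by (simp add: T_def)
  next
    case len: True
    define c where "c = p - 1"
    have p: "p = Suc c" using len flag_nonempty[OF G] by (cases p) (auto simp: c_def)
    have last: "last G = G ! c" using len p by (simp add: last_conv_nth[OF flag_nonempty[OF G]])
    have Y: "G ! c \<in> intersections n f" "codim (G ! c) = c"
      using len p by (auto simp: flag_nth[OF G] flag_codim[OF G])
    have Jn: "J ! i \<le> n" if "i < p" for i
      using nth_le[OF J] that by (simp add: p_def)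
    define h where "h i = level G (J ! i)" for i
    have "flag_eval f (G @ [X]) J =
        fdet p (\<lambda>i. (h i)(c := contained X (J ! i) - contained (G ! c) (J ! i)))" if X: "X \<in> T" for X
      unfolding flag_eval_eq_fdet[OF fl[OF X] J] p_def[symmetric] using len p
      by (auto simp: level_def h_def nth_append intro!: fdet_cong)
    then have "(\<Sum>X\<in>T. flag_eval f (G @ [X]) J) =
        fdet p (\<lambda>i. (h i)(c := \<Sum>X\<in>T. contained X (J ! i) - contained (G ! c) (J ! i)))"
      by (subst fdet_column_sum) (auto simp: p)
    also have "\<dots> = fdet p (\<lambda>i. (h i)(c := 1 - (\<Sum>k<c. h i k)))"
    proof (rule fdet_cong)
      fix i k assume i: "i < p"
      have "(\<Sum>X\<in>T. contained X (J ! i) - contained (G ! c) (J ! i)) = 1 - contained (G ! c) (J ! i)"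
        using sum_contained_covers[OF Y(1) Jn[OF i]] by (simp add: T_def last len p Y(2))
      \<comment> \<open>The earlier columns telescope down to the first space, which is the whole
        space and lies in no hyperplane.\<close>
      moreover have "(\<Sum>k<c. h i k) = contained (G ! c) (J ! i) - contained (G ! 0) (J ! i)"
        unfolding h_def level_def by (rule sum_lessThan_telescope)
      moreover have "contained (G ! 0) (J ! i) = 0"
        using not_UNIV_subset_hyp[OF Jn[OF i]] by (simp add: flag_first[OF G] contained_def)
      ultimately show "((h i)(c := \<Sum>X\<in>T. contained X (J ! i) - contained (G ! c) (J ! i))) k =
          ((h i)(c := 1 - (\<Sum>k<c. h i k))) k" by simp
    qed
    also have "\<dots> = fdet p (\<lambda>i. (h i)(c := 1)) - fdet p (\<lambda>i. (h i)(c := \<Sum>k<c. h i k))"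
      by (rule fdet_column_diff) (simp add: p)
    also have "fdet p (\<lambda>i. (h i)(c := \<Sum>k<c. h i k)) = (\<Sum>k<c. fdet p (\<lambda>i. (h i)(c := h i k)))"
      by (rule fdet_column_sum) (simp add: p)
    also have "\<dots> = 0"
    proof (intro sum.neutral ballI)
      fix k assume "k \<in> {..<c}"
      then show "fdet p (\<lambda>i. (h i)(c := h i k)) = 0"
        by (intro fdet_equal_columns[of c _ k]) (simp_all add: p)
    qed
    \<comment> \<open>In the expansion along the column of ones, the minor of row \<open>k\<close>
      is the determinant of \<open>G\<close> on \<open>J\<close> without its \<open>k\<close>-th
      entry.\<close>
    also have "fdet p (\<lambda>i. (h i)(c := 1)) - 0 = (\<Sum>k<p. (-1) ^ (k + c) * flag_eval f G (drop_nth k J))"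
      unfolding diff_zero
    proof (subst fdet_column[of c], simp add: p, intro sum.cong refl)
      fix k assume k: "k \<in> {..<p}"
      have "flag_eval f G (drop_nth k J) = fdet c (\<lambda>i. level G (drop_nth k J ! i))"
        unfolding flag_eval_eq_fdet[OF G Jk] using k len p by (simp add: p_def)
      also have "\<dots> = fdet (p - 1) (\<lambda>i l. ((h (if i < k then i else Suc i))(c := 1)) (if l < c then l else Suc l))"
        using k p by (auto simp: h_def nth_drop_nth p_def intro!: fdet_cong)
      finally show "(-1) ^ (k + c) * ((h k)(c := 1)) c *
          fdet (p - 1) (\<lambda>i l. ((h (if i < k then i else Suc i))(c := 1)) (if l < c then l else Suc l)) =
          (-1) ^ (k + c) * flag_eval f G (drop_nth k J)" by simp
    qed
    finally show ?thesis by (simp add: T_def c_def p_def)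
  qed
qed

lemma pair_pre_diff:
  assumes J: "set J \<subseteq> {..n}"
  shows "pair (pre_diff n f c) J =
    (\<Sum>k<length J. (-1) ^ (k + (length J - 1)) * pair c (drop_nth k J))"
proof -
  let ?T = "\<lambda>G. {X. X \<in> intersections n f \<and> X \<subset> last G \<and> codim X = length G}"
  have "pre_diff n f c = (\<Sum>G\<in>flags n f. (\<lambda>G'. c G * (\<Sum>X\<in>?T G. flag_vec (G @ [X])) G'))"
    by (intro ext) (simp add: pre_diff_def sum_fun_apply)
  then have "pair (pre_diff n f c) J =
      (\<Sum>G\<in>flags n f. pair (\<lambda>G'. c G * (\<Sum>X\<in>?T G. flag_vec (G @ [X])) G') J)"
    by (simp only: pair_sum)
  also have "\<dots> = (\<Sum>G\<in>flags n f. c G * pair (\<Sum>X\<in>?T G. flag_vec (G @ [X])) J)"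
    by (simp add: pair_def sum_distrib_left mult.assoc)
  also have "\<dots> = (\<Sum>G\<in>flags n f. c G *
      (\<Sum>k<length J. (-1) ^ (k + (length J - 1)) * flag_eval f G (drop_nth k J)))"
  proof (intro sum.cong refl arg_cong2[where f = "(*)"])
    fix G assume G: "G \<in> flags n f"
    have "pair (\<Sum>X\<in>?T G. flag_vec (G @ [X])) J = (\<Sum>X\<in>?T G. flag_eval f (G @ [X]) J)"
      unfolding pair_sum by (intro sum.cong refl pair_flag_vec append_flag[OF G]) auto
    then show "pair (\<Sum>X\<in>?T G. flag_vec (G @ [X])) J =
        (\<Sum>k<length J. (-1) ^ (k + (length J - 1)) * flag_eval f G (drop_nth k J))"
      by (simp only: sum_flag_eval_extend[OF G J])
  qed
  also have "\<dots> = (\<Sum>k<length J. (-1) ^ (k + (length J - 1)) * pair c (drop_nth k J))"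
    unfolding pair_def sum_distrib_left by (subst sum.swap) (simp add: algebra_simps)
  finally show ?thesis .
qed

text \<open>Makes \<open>pre_diff n f c\<close> related to itself, so that the differential of a
  nonempty set is nonempty.\<close>

lemma pre_diff_in_free_flags: "pre_diff n f c \<in> free_flags n f"
proof -
  have "flag_vec (G @ [X]) G' = 0" if "G' \<notin> flags n f" "G \<in> flags n f"
    "X \<in> intersections n f" "X \<subset> last G" "codim X = length G" for G G' X
    using that append_flag[of G X "[]"] by (auto simp: flag_vec_def)
  then show ?thesis
    unfolding free_flags_def pre_diff_def by (auto intro!: sum.neutral)
qed


section \<open>The contravariant form\<close>

text \<open>All representatives in \<open>F\<close> have the values \<open>P\<close>, and all
  expansions of \<open>u\<close> give the same number, so the definite description is
  determined.\<close>

lemma flag_pairing_eq: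
  assumes F: "F \<noteq> {}" "\<And>c J. c \<in> F \<Longrightarrow> J \<in> increasing_tuples n \<Longrightarrow> pair c J = P J"
    and T: "finite T" "K ` T \<subseteq> increasing_tuples n"
    and u: "u = (\<lambda>x vs. \<Sum>t\<in>T. b t * omega_mono n f (K t) x vs)"
  shows "flag_pairing n f F u = (\<Sum>t\<in>T. b t * P (K t))"
proof -
  define b' where "b' J = (\<Sum>t\<in>{t \<in> T. K t = J}. b t)" for J
  have u': "u = (\<lambda>x vs. \<Sum>J\<in>increasing_tuples n. b' J * omega_mono n f J x vs)"
    unfolding u b'_def by (simp only: sum_increasing_tuples_fibres[OF T, of b "\<lambda>J. omega_mono n f J _ _"])
  have val: "(\<Sum>G\<in>flags n f. \<Sum>J\<in>increasing_tuples n. c G * b' J * flag_eval f G J) =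
      (\<Sum>t\<in>T. b t * P (K t))" if c: "c \<in> F" for c
  proof -
    have "(\<Sum>G\<in>flags n f. \<Sum>J\<in>increasing_tuples n. c G * b' J * flag_eval f G J) =
        (\<Sum>J\<in>increasing_tuples n. b' J * pair c J)"
      unfolding pair_def sum_distrib_left by (subst sum.swap) (simp add: mult.assoc mult.left_commute)
    also have "\<dots> = (\<Sum>J\<in>increasing_tuples n. b' J * P J)"
      using F(2)[OF c] by (intro sum.cong refl) simp
    also have "\<dots> = (\<Sum>t\<in>T. b t * P (K t))"
      unfolding b'_def by (rule sum_increasing_tuples_fibres[OF T])
    finally show ?thesis .
  qed
  show ?thesis
    unfolding flag_pairing_def
  proof (rule the_equality)
    obtain c where c: "c \<in> F" using F(1) by blast
    show "\<exists>c\<in>F. \<exists>b''. u = (\<lambda>x vs. \<Sum>J\<in>increasing_tuples n. b'' J * omega_mono n f J x vs) \<and>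
        (\<Sum>t\<in>T. b t * P (K t)) = (\<Sum>G\<in>flags n f. \<Sum>J\<in>increasing_tuples n. c G * b'' J * flag_eval f G J)"
      by (intro bexI[OF _ c] exI[of _ b'] conjI u' val[OF c, symmetric])
  next
    fix z
    assume "\<exists>c\<in>F. \<exists>b. u = (\<lambda>x vs. \<Sum>J\<in>increasing_tuples n. b J * omega_mono n f J x vs) \<and>
        z = (\<Sum>G\<in>flags n f. \<Sum>J\<in>increasing_tuples n. c G * b J * flag_eval f G J)"
    then obtain c b'' where c: "c \<in> F"
      and u'': "u = (\<lambda>x vs. \<Sum>J\<in>increasing_tuples n. b'' J * omega_mono n f J x vs)"
      and z: "z = (\<Sum>G\<in>flags n f. \<Sum>J\<in>increasing_tuples n. c G * b'' J * flag_eval f G J)"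
      by (elim bexE exE conjE) (rule that)
    have "z = (\<Sum>G\<in>flags n f. \<Sum>J\<in>increasing_tuples n. c G * b' J * flag_eval f G J)"
      unfolding z mult.assoc sum_distrib_left[symmetric]
      using flag_eval_well_defined[OF _ trans[OF u''[symmetric] u']]
      by (intro sum.cong refl) simp
    then show "z = (\<Sum>t\<in>T. b t * P (K t))" by (simp only: val[OF c])
  qed
qed

lemma flag_pairing_omega_mono:
  assumes "F \<noteq> {}" "\<And>c J. c \<in> F \<Longrightarrow> J \<in> increasing_tuples n \<Longrightarrow> pair c J = P J"
    and J: "J \<in> increasing_tuples n"
  shows "flag_pairing n f F (omega_mono n f J) = P J"
  using flag_pairing_eq[OF assms(1,2), of "{()}" "\<lambda>_. J" "omega_mono n f J" "\<lambda>_. 1"] J by simp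

section \<open>Classes, differentials and the form in terms of values on monomials\<close>

lemma flag_class_pair:
  assumes "F \<in> flag_space n f"
  obtains P where "F \<noteq> {}" "\<forall>c\<in>F. \<forall>J. set J \<subseteq> {..n} \<longrightarrow> pair c J = P J"
proof -
  obtain c where c: "c \<in> free_flags n f" "F = flag_rel n f `` {c}"
    using assms by (auto simp: flag_space_def elim: quotientE)
  have "c \<in> F" using c by (simp add: flag_rel_def fun_vs.span_zero)
  then show ?thesis
    using c(2) by (intro that[of "pair c"]) (auto intro: pair_flag_rel)
qed

text \<open>\<open>flag_diff\<close> is a union over all representatives; its members share their
  values on monomials because the values of \<open>pre_diff n f c\<close> depend only on those of
  \<open>c\<close>.\<close>

lemma flag_diff_pair:
  assumes "F \<noteq> {}" and P: "\<And>c J. c \<in> F \<Longrightarrow> set J \<subseteq> {..n} \<Longrightarrow> pair c J = P J"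
  shows "flag_diff n f F \<noteq> {}"
    and "g \<in> flag_diff n f F \<Longrightarrow> set J \<subseteq> {..n} \<Longrightarrow>
      pair g J = (\<Sum>k<length J. (-1) ^ (k + (length J - 1)) * P (drop_nth k J))"
proof -
  obtain c where "c \<in> F" using assms by blast
  then have "pre_diff n f c \<in> flag_diff n f F"
    unfolding flag_diff_def
    by (intro UN_I[of c]) (simp_all add: flag_rel_def pre_diff_in_free_flags fun_vs.span_zero)
  then show "flag_diff n f F \<noteq> {}" by blast
next
  assume "g \<in> flag_diff n f F" and J: "set J \<subseteq> {..n}"
  then obtain c where c: "c \<in> F" "(pre_diff n f c, g) \<in> flag_rel n f"
    by (auto simp: flag_diff_def)
  have "set (drop_nth k J) \<subseteq> {..n}" for k
    using set_drop_nth_subset[of k J] J by blast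
  then show "pair g J = (\<Sum>k<length J. (-1) ^ (k + (length J - 1)) * P (drop_nth k J))"
    by (simp add: pair_flag_rel[OF c(2) J] pair_pre_diff[OF J] P[OF c(1)])
qed

text \<open>Lengths of increasing tuples are at most \<open>n + 1\<close>, so the sum over degrees
  runs through each tuple exactly once.\<close>

lemma contravariant_form_eq:
  assumes "F \<noteq> {}" "\<And>c J. c \<in> F \<Longrightarrow> J \<in> increasing_tuples n \<Longrightarrow> pair c J = P J"
    and "F' \<noteq> {}" "\<And>c J. c \<in> F' \<Longrightarrow> J \<in> increasing_tuples n \<Longrightarrow> pair c J = P' J"
  shows "contravariant_form n f a F F' = (\<Sum>J\<in>increasing_tuples n. (\<Prod>j\<in>set J. a j) * P J * P' J)"
proof -
  have "contravariant_form n f a F F' = (\<Sum>p\<le>n + 1. \<Sum>J | J \<in> increasing_tuples n \<and> length J = p.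
      (\<Prod>j\<in>set J. a j) * P J * P' J)"
    unfolding contravariant_form_def contravariant_deg_def
    by (intro sum.cong refl)
      (auto simp: flag_pairing_omega_mono[OF assms(1,2)] flag_pairing_omega_mono[OF assms(3,4)]
        prod_increasing_tuple)
  also have "\<dots> = (\<Sum>J\<in>increasing_tuples n. (\<Prod>j\<in>set J. a j) * P J * P' J)"
    using length_increasing_tuple by (intro sum.group) fastforce+
  finally show ?thesis .
qed

text \<open>Indices already in \<open>I\<close> contribute a repeated factor and vanish; the others
  are moved to their sorted place.\<close>

lemma wedge_omega_weight_omega_mono:
  "wedge (omega_weight n f a) (omega_mono n f I) =
    (\<lambda>x vs. \<Sum>i\<in>{..n} - set I. (a i * (-1) ^ position i I) * omega_mono n f (insort i I) x vs)"
proof (intro ext)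
  fix x vs
  have "wedge (omega_weight n f a) (omega_mono n f I) x vs =
      (\<Sum>i\<le>n. a i * omega_mono n f (i # I) x vs)"
    by (simp add: wedge_omega_weight omega_mono_Cons)
  also have "\<dots> = (\<Sum>i\<in>{..n} - set I. a i * omega_mono n f (i # I) x vs)"
    by (intro sum.mono_neutral_right) (auto simp: omega_mono_repeated)
  finally show "wedge (omega_weight n f a) (omega_mono n f I) x vs =
      (\<Sum>i\<in>{..n} - set I. (a i * (-1) ^ position i I) * omega_mono n f (insort i I) x vs)"
    by (simp add: omega_mono_insort mult.assoc)
qed

lemma Ann_orthogonal_flag_diff:
  assumes F: "F \<in> Ann n f {wedge (omega_weight n f a) u | u. u \<in> OS_algebra n f}"
    and G: "G \<in> flag_space n f"
  shows "contravariant_form n f a F (flag_diff n f G) = 0"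
proof -
  have "F \<in> flag_space n f" using F by (simp add: Ann_def)
  then obtain P where P: "F \<noteq> {}" "\<forall>c\<in>F. \<forall>J. set J \<subseteq> {..n} \<longrightarrow> pair c J = P J"
    by (rule flag_class_pair)
  from G obtain Q where Q: "G \<noteq> {}" "\<forall>c\<in>G. \<forall>J. set J \<subseteq> {..n} \<longrightarrow> pair c J = Q J"
    by (rule flag_class_pair)
  note P = P[rule_format] and Q = Q[rule_format]
  have sub: "set J \<subseteq> {..n}" if "J \<in> increasing_tuples n" for J
    using that by (simp add: increasing_tuples_def)
  \<comment> \<open>The hypothesis on \<open>F\<close> for the monomial of \<open>I\<close>, with
    the wedge product expanded in increasing monomials.\<close>
  have ann: "(\<Sum>i\<in>{..n} - set I. (a i * (-1) ^ position i I) * P (insort i I)) = 0"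
    if I: "I \<in> increasing_tuples n" for I
  proof -
    have "flag_pairing n f F (wedge (omega_weight n f a) (omega_mono n f I)) =
        (\<Sum>i\<in>{..n} - set I. (a i * (-1) ^ position i I) * P (insort i I))"
      by (rule flag_pairing_eq[OF P(1) _ _ _ wedge_omega_weight_omega_mono])
        (auto simp: P(2) sub insort_in_increasing_tuples[OF I])
    moreover have "flag_pairing n f F (wedge (omega_weight n f a) (omega_mono n f I)) = 0"
      using F omega_mono_in_OS_algebra[OF sub[OF I], of f] by (auto simp: Ann_def)
    ultimately show ?thesis by simp
  qed
  have "contravariant_form n f a F (flag_diff n f G) =
      (\<Sum>J\<in>increasing_tuples n. (\<Prod>j\<in>set J. a j) * P J *
        (\<Sum>k<length J. (-1) ^ (k + (length J - 1)) * Q (drop_nth k J)))"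
    using P flag_diff_pair[OF Q] sub by (intro contravariant_form_eq) auto
  also have "\<dots> = (\<Sum>J\<in>increasing_tuples n. \<Sum>k<length J. (\<Prod>j\<in>set J. a j) * P J *
      ((-1) ^ (k + (length J - 1)) * Q (drop_nth k J)))"
    by (simp only: sum_distrib_left)
  also have "\<dots> = (\<Sum>I\<in>increasing_tuples n. \<Sum>i\<in>{..n} - set I. (\<Prod>j\<in>set (insort i I). a j) * P (insort i I) *
      ((-1) ^ (position i I + (length (insort i I) - 1)) * Q (drop_nth (position i I) (insort i I))))"
    by (rule sum_increasing_tuples_reindex)
  \<comment> \<open>\<open>insort i I\<close> has one entry more than \<open>I\<close>, so the sign
    splits into a factor depending on \<open>I\<close> alone and the sign of the insertion. The
    weight splits off \<open>a i\<close>, and the inner sum is the one in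
    \<open>ann\<close>.\<close>
  also have "\<dots> = (\<Sum>I\<in>increasing_tuples n. (\<Prod>j\<in>set I. a j) * (-1) ^ length I * Q I *
      (\<Sum>i\<in>{..n} - set I. (a i * (-1) ^ position i I) * P (insort i I)))"
    unfolding sum_distrib_left
    by (intro sum.cong refl) (simp add: set_insort_key drop_nth_position_insort power_add mult_ac)
  also have "\<dots> = 0" by (simp add: ann)
  finally show ?thesis .
qed

end

theorem theorem4p2:
  fixes n :: nat
    and f :: "nat \<Rightarrow> complex^'m \<Rightarrow> complex"
    and a :: "nat \<Rightarrow> complex"
  assumes "central_arrangement n f"
  shows "\<forall>F \<in> Ann n f {wedge (omega_weight n f a) u | u. u \<in> OS_algebra n f}.
           \<forall>G \<in> flag_diff n f ` flag_space n f. contravariant_form n f a F G = 0"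
proof -
  interpret arrangement n f by unfold_locales (rule assms)
  show ?thesis by (auto intro: Ann_orthogonal_flag_diff)
qed

end
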